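(* There exist absolute constants $c_0, C_1 > 0$ such that the following holds. Let $0 < p \le \tfrac12$, and let $\epsilon \le c_0/\ln(1/p)$. Let $f : \{0,1\}^n \to \{0,1\}$ be a Boolean function such that $$p\, I^p[f] \le \mu_p(f)\left(\log_p(\mu_p(f)) + \epsilon\right).$$ Then there exists a subcube $S \subset \{0,1\}^n$ such that $$\mu_p(f \Delta 1_S) \le C_1\, \frac{\epsilon \ln(1/p)}{\ln\left(1/(\epsilon \ln(1/p))\right)}\, \mu_p(f),$$ where $f \Delta 1_S := \{x : f(x) \ne 1_S(x)\}$.
   Context: Here $n$ is a positive integer and $[n]=\{1,\dots,n\}$. For $p \in (0,1)$, $\mu_p$ is the $p$-biased measure on $\{0,1\}^n$: $\mu_p(\{x\}) = p^{\sum_i x_i}(1-p)^{n-\sum_i x_i}$. For a Boolean function $f:\{0,1\}^n\to\{0,1\}$, $\mu_p(f) := \mathbb{E}_{x\sim\mu_p}[f(x)]$. For $i \in [n]$, $I_i^p[f] := \Pr_{x\sim\mu_p}[f(x)\ne f(x\oplus e_i)]$, where $x \oplus e_i$ is $x$ with its $i$th coordinate flipped, and $I^p[f] := \sum_{i=1}^n I_i^p[f]$. $\log_p$ denotes the logarithm to base $p$, with the convention $0\log_p(0)=0$. A subcube of $\{0,1\}^n$ is a set of the form $\{x \in\{0,1\}^n : x_i = a_i \ \forall i \in F\}$, where $F \subset [n]$ and $a_i\in\{0,1\}$ for all $i \in F$. $1_S$ is the indicator function of $S$, i.e. the Boolean function equal to $1$ on $S$ and $0$ outside $S$.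
   Formalization: The function f is assumed not identically 0: for f = 0 the hypothesis holds as 0 ≤ 0, but no subcube S has measure 0, so the claim fails there; at ε = 0 the bound is read as its limit 0. *)

theory Defs
  imports "HOL-Analysis.Analysis"
begin

text \<open>
  The cube $\{0,1\}^n$ is the set of extensional functions from $\{1,\dots,n\}$ to
  $\{0,1\}$, so that \<open>n\<close> can be quantified after the absolute constants.  A Boolean function
  is a function \<open>f\<close> with \<open>f \<in> cube n \<rightarrow> {0,1}\<close>; its values outside the cube play no role.
\<close>

definition cube :: "nat \<Rightarrow> (nat \<Rightarrow> nat) set" where
  "cube n = {1..n} \<rightarrow>\<^sub>E {0,1}"

definition biased_mass :: "nat \<Rightarrow> real \<Rightarrow> (nat \<Rightarrow> nat) \<Rightarrow> real" where
  "biased_mass n p x = p ^ (\<Sum>i\<in>{1..n}. x i) * (1 - p) ^ (n - (\<Sum>i\<in>{1..n}. x i))"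

definition biased_measure :: "nat \<Rightarrow> real \<Rightarrow> (nat \<Rightarrow> nat) set \<Rightarrow> real" where
  "biased_measure n p A = (\<Sum>x\<in>A \<inter> cube n. biased_mass n p x)"

definition biased_mean :: "nat \<Rightarrow> real \<Rightarrow> ((nat \<Rightarrow> nat) \<Rightarrow> nat) \<Rightarrow> real" where
  "biased_mean n p f = (\<Sum>x\<in>cube n. biased_mass n p x * real (f x))"

definition flip_coord :: "(nat \<Rightarrow> nat) \<Rightarrow> nat \<Rightarrow> (nat \<Rightarrow> nat)" where
  "flip_coord x i = x(i := 1 - x i)"

definition influence :: "nat \<Rightarrow> real \<Rightarrow> nat \<Rightarrow> ((nat \<Rightarrow> nat) \<Rightarrow> nat) \<Rightarrow> real" where
  "influence n p i f = biased_measure n p {x \<in> cube n. f x \<noteq> f (flip_coord x i)}"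

definition total_influence :: "nat \<Rightarrow> real \<Rightarrow> ((nat \<Rightarrow> nat) \<Rightarrow> nat) \<Rightarrow> real" where
  "total_influence n p f = (\<Sum>i\<in>{1..n}. influence n p i f)"

text \<open>A subcube is never empty; \<open>F = {}\<close> gives the whole cube.\<close>

definition subcube :: "nat \<Rightarrow> (nat \<Rightarrow> nat) set \<Rightarrow> bool" where
  "subcube n S \<longleftrightarrow>
     (\<exists>F a. F \<subseteq> {1..n} \<and> a \<in> F \<rightarrow> {0,1} \<and> S = {x \<in> cube n. \<forall>i\<in>F. x i = a i})"

definition sym_diff_set ::
  "nat \<Rightarrow> ((nat \<Rightarrow> nat) \<Rightarrow> nat) \<Rightarrow> ((nat \<Rightarrow> nat) \<Rightarrow> nat) \<Rightarrow> (nat \<Rightarrow> nat) set" where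
  "sym_diff_set n f g = {x \<in> cube n. f x \<noteq> g x}"

end

theory Submission
  imports Defs
begin

text \<open>
  Write \<open>L = ln (1/p)\<close>. For a nonempty set \<open>A\<close> with measure \<open>m\<close>, the deficit \<open>L p I(A) + m ln m\<close> is shown to
  be at least \<open>m \<phi>(\<eta>) / 1000\<close>, where \<open>\<phi>(x) = x (1 - ln x)\<close> and \<open>\<eta> m\<close> is the measure of the symmetric
  difference of \<open>A\<close> and the closest subcube. The induction splits off one coordinate.
  If \<open>q\<close> is the conditional probability of \<open>x\<^sub>n = 1\<close> in \<open>A\<close>, the normalised deficit is the \<open>q\<close>-average of the
  deficits of the two sections plus \<open>\<iota> - kl q p\<close>, with \<open>\<iota> = L p I\<^sub>n(A) / m \<ge> L \<bar>q - p\<bar> / (1 - p)\<close>.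
  When \<open>q\<close> is far from \<open>p\<close>, this gain pays for discarding the lighter section. When \<open>q\<close> is
  comparable with \<open>p\<close>, the gain is at least \<open>\<iota> / 10\<close>, and \<open>\<iota>\<close> measures how much the two sections differ.
  Then either both sections have the same best subcube, and \<open>\<iota>\<close> pays for the concavity of \<open>\<phi>\<close>, or
  (distinct subcubes being at relative distance at least \<open>p\<close>) the difference of the sections
  or both of their errors are at least of order \<open>p\<close>, and \<open>\<iota>\<close> pays for using the subcube of one section in both.
\<close>

section \<open>The function phi\<close>

text \<open>The entropy term \<open>- x ln x\<close> plus \<open>x\<close>. The summand
  \<open>x\<close> makes the derivative \<open>- ln x\<close>, so that \<open>phi\<close> increases
  on all of [0, 1] and dominates the identity there.\<close>

definition phi :: "real \<Rightarrow> real" where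
  "phi x = x * (1 - ln x)"

lemma phi_0 [simp]: "phi 0 = 0"
  by (simp add: phi_def)

lemma ln_ge_one_minus_inverse: "1 - 1 / x \<le> ln x" if "x > 0" for x :: real
  using ln_le_minus_one[of "1 / x"] that by (simp add: ln_div)

text \<open>Concavity: the tangent at \<open>x\<close> has slope \<open>- ln x\<close> and lies
  above the graph. This is \<open>ln t <= t - 1\<close> at \<open>t = x / y\<close>.\<close>

lemma phi_tangent: "phi y \<le> phi x - (y - x) * ln x" if "x > 0" "y \<ge> 0"
proof (cases "y = 0")
  case False
  have "y * ln (x / y) \<le> y * (x / y - 1)"
    using that False by (intro mult_left_mono ln_le_minus_one) auto
  also have "\<dots> = x - y"
    using False by (simp add: field_simps)
  finally show ?thesis
    using that False by (simp add: phi_def ln_div algebra_simps)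
qed (use that in \<open>simp add: phi_def algebra_simps\<close>)

lemma phi_mono: "phi x \<le> phi y" if "0 \<le> x" "x \<le> y" "y \<le> 1"
proof (cases "y = 0")
  case False
  then have "0 \<le> (x - y) * ln y"
    using that by (intro mult_nonpos_nonpos) auto
  then show ?thesis
    using phi_tangent[of y x] False that by auto
qed (use that in auto)

lemma phi_nonneg: "0 \<le> phi x" if "0 \<le> x" "x \<le> 1"
  using phi_mono[of 0 x] that by simp

lemma phi_ge_self: "x \<le> phi x" if "0 \<le> x" "x \<le> 1"
proof -
  have "x * ln x \<le> 0"
    using that by (cases "x = 0") (auto intro!: mult_nonneg_nonpos)
  then show ?thesis
    by (simp add: phi_def algebra_simps)
qed

lemma phi_subadd: "phi (a + b) \<le> phi a + phi b" if "0 \<le> a" "0 \<le> b"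
proof (cases "a = 0 \<or> b = 0")
  case False
  then have "a * ln a \<le> a * ln (a + b)" "b * ln b \<le> b * ln (a + b)"
    using that by auto
  then show ?thesis
    by (simp add: phi_def algebra_simps)
qed auto

lemma phi_mult: "phi (q * a) = q * phi a - q * a * ln q" if "q > 0" "a \<ge> 0"
  using that by (cases "a = 0") (auto simp: phi_def ln_mult algebra_simps)

text \<open>Cost of discarding a section of weight \<open>1 - q\<close>. Subadditivity gives one
  \<open>phi (1 - q)\<close>; the second pays for the factor \<open>q\<close> inside
  \<open>phi\<close>, since \<open>- q ln q <= 1 - q <= phi (1 - q)\<close>.\<close>

lemma phi_convex_split: "phi (q * a + (1 - q)) \<le> q * phi a + 2 * phi (1 - q)"
  if "0 < q" "q < 1" "0 \<le> a" "a \<le> 1"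
proof -
  have *: "- (q * ln q) \<le> 1 - q"
    using mult_left_mono[OF ln_ge_one_minus_inverse[of q], of q] that
    by (simp add: algebra_simps)
  have "- (q * a * ln q) = a * - (q * ln q)"
    by simp
  also have "\<dots> \<le> 1 * (1 - q)"
    using * that by (intro mult_mono) (auto intro!: mult_nonneg_nonpos)
  finally show ?thesis
    using phi_subadd[of "q * a" "1 - q"] phi_mult[of q a] phi_ge_self[of "1 - q"] that
    by simp
qed

text \<open>From a point \<open>a >= t\<close> on, the slope of \<open>phi\<close> is at most
  \<open>ln (1 / t)\<close>. If instead \<open>a < t <= y\<close>, subadditivity applies, and
  \<open>phi y\<close> is itself at most \<open>y (1 + ln (1 / t))\<close>.\<close>

lemma phi_increment: "phi z \<le> phi a + y * (1 + ln (1 / t))"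
  if "0 \<le> a" "a \<le> 1" "0 \<le> y" "0 < t" "t \<le> 1 / 2" "t \<le> a \<or> t \<le> y"
     "0 \<le> z" "z \<le> 1" "z \<le> a + y"
proof -
  have B: "0 \<le> ln (1 / t)"
    using that by simp
  \<comment> \<open>Truncation keeps \<open>a + y'\<close> inside [0, 1], where \<open>phi\<close>
    is monotone. The dichotomy survives: if \<open>a < t <= 1 / 2\<close>, then
    \<open>1 - a >= t\<close>.\<close>
  define y' where "y' = min y (1 - a)"
  have y': "0 \<le> y'" "y' \<le> y" "a + y' \<le> 1" "t \<le> a \<or> t \<le> y'" "z \<le> a + y'"
    using that by (auto simp: y'_def)
  have "phi z \<le> phi (a + y')"
    using that y' by (intro phi_mono) auto
  also have "\<dots> \<le> phi a + y' * (1 + ln (1 / t))"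
  proof (cases "t \<le> a")
    case True
    then have "ln t \<le> ln a"
      using that by auto
    then have "- ln a \<le> 1 + ln (1 / t)"
      using that by (simp only: ln_div) simp
    then have "y' * - ln a \<le> y' * (1 + ln (1 / t))"
      using y' by (intro mult_left_mono) auto
    then show ?thesis
      using phi_tangent[of a "a + y'"] y' that True by simp
  next
    case False
    then have t: "t \<le> y'"
      using y' by auto
    then have "ln t \<le> ln y'"
      using that by auto
    then have "1 - ln y' \<le> 1 + ln (1 / t)"
      using that by (simp only: ln_div) simp
    then have "y' * (1 - ln y') \<le> y' * (1 + ln (1 / t))"
      using y' by (intro mult_left_mono) auto
    then show ?thesis
      using phi_subadd[of a y'] y' that by (simp add: phi_def)
  qed
  also have "y' * (1 + ln (1 / t)) \<le> y * (1 + ln (1 / t))"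
    using y' B by (intro mult_right_mono) auto
  finally show ?thesis by simp
qed

section \<open>Jensen gap of \<open>phi\<close>\<close>

lemma phi_jensen_gap_aux:
  assumes "0 < w" "w < 1" "0 \<le> b" "b \<le> a"
  shows "phi (w * a + (1 - w) * b) \<le> w * phi a + (1 - w) * phi b - (a - b) * w * ln w"
proof (cases "b = 0")
  case True
  then show ?thesis
    using phi_mult[of w a] assms by (simp add: algebra_simps)
next
  case False
  then have pos: "0 < b" "0 < a" using assms by auto
  define m where "m = w * a + (1 - w) * b"
  have m: "b \<le> m" "m = b + w * (a - b)"
    using assms by (auto simp: m_def algebra_simps)
  then have "m > 0" using pos by auto
  txt \<open>After splitting \<open>w a = w (a - b) + w b\<close>, only the first part contributes positively; there
    \<open>w a \<le> m\<close> bounds \<open>ln (a / m)\<close> by \<open>- ln w\<close>.\<close>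
  have "w * a * ln (a / m) + (1 - w) * b * ln (b / m) \<le> - ((a - b) * w * ln w)"
  proof (cases "a = b")
    case True
    then show ?thesis using m by (simp)
  next
    case False
    then have ab: "a - b > 0" using assms by auto
    have 1: "w * (a - b) * ln (w * a / m) \<le> 0"
      using ab assms \<open>m > 0\<close> pos by (intro mult_nonneg_nonpos) (auto simp: m_def)
    have 2: "w * b * ln (a / m) \<le> w * b * (a / m - 1)"
      using assms pos \<open>m > 0\<close> by (intro mult_left_mono ln_le_minus_one) auto
    have 3: "(1 - w) * b * ln (b / m) \<le> (1 - w) * b * (b / m - 1)"
      using assms pos \<open>m > 0\<close> by (intro mult_left_mono ln_le_minus_one) auto
    have "w * b * (a / m - 1) + (1 - w) * b * (b / m - 1) = b * ((w * a + (1 - w) * b) / m) - b"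
      using \<open>m > 0\<close> by (simp add: field_simps)
    also have "\<dots> = 0" using \<open>m > 0\<close> by (simp add: m_def)
    finally have "w * b * ln (a / m) + (1 - w) * b * ln (b / m) \<le> 0"
      using 2 3 by linarith
    then show ?thesis
      using 1 assms pos \<open>m > 0\<close> by (simp add: ln_div ln_mult algebra_simps)
  qed
  then show ?thesis
    using pos \<open>m > 0\<close> unfolding phi_def m_def[symmetric]
    by (simp add: ln_div algebra_simps) (simp add: m_def algebra_simps)
qed

text \<open>Averaging two errors loses an amount linear in their difference, at rate of order
  \<open>q ln (1 / q)\<close>, which the influence can pay for when \<open>q\<close> is of order
  \<open>p\<close>. If the larger error has weight \<open>1 - q\<close>, the rate is only smaller,
  as \<open>- (1 - q) ln (1 - q) <= q\<close>.\<close>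

lemma phi_jensen_gap:
  assumes "0 < q" "q < 1" "0 \<le> a" "0 \<le> b"
  shows "phi (q * a + (1 - q) * b) \<le> q * phi a + (1 - q) * phi b + \<bar>a - b\<bar> * (q * (1 + ln (1 / q)))"
proof (cases "b \<le> a")
  case True
  have "(a - b) * q \<ge> 0"
    using True assms by simp
  moreover have "\<bar>a - b\<bar> * (q * (1 + ln (1 / q))) = (a - b) * q - (a - b) * q * ln q"
    using True assms by (simp add: ln_div algebra_simps)
  ultimately show ?thesis
    using phi_jensen_gap_aux[of q b a] assms True by linarith
next
  case False
  have "- ((1 - q) * ln (1 - q)) \<le> q"
    using mult_left_mono[OF ln_ge_one_minus_inverse[of "1 - q"], of "1 - q"] assms
    by (simp add: algebra_simps)
  also have "q \<le> q * (1 + ln (1 / q))"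
    using assms by simp
  finally have "(b - a) * - ((1 - q) * ln (1 - q)) \<le> (b - a) * (q * (1 + ln (1 / q)))"
    using False by (intro mult_left_mono) auto
  then show ?thesis
    using phi_jensen_gap_aux[of "1 - q" a b] assms False by (simp add: algebra_simps)
qed

section \<open>Relative entropy of two coins\<close>

definition kl :: "real \<Rightarrow> real \<Rightarrow> real" where
  "kl q p = q * ln (q / p) + (1 - q) * ln ((1 - q) / (1 - p))"

text \<open>Exact to second order at 1, unlike \<open>ln u <= u - 1\<close>;
  \<open>kl_le_linear\<close> needs this precision to reach \<open>q = 9 p / 5\<close>.\<close>

lemma ln_le_half_diff_inverse:
  fixes u :: real
  assumes "1 \<le> u"
  shows "ln u \<le> (u - 1 / u) / 2"
proof -
  have "(\<lambda>u. (u - 1 / u) / 2 - ln u) 1 \<le> (\<lambda>u. (u - 1 / u) / 2 - ln u) u"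
  proof (rule DERIV_nonneg_imp_nondecreasing[OF assms])
    fix x :: real assume x: "1 \<le> x" "x \<le> u"
    have "((\<lambda>u. (u - 1 / u) / 2 - ln u) has_real_derivative ((x - 1)\<^sup>2 / (2 * x\<^sup>2))) (at x)"
      using x by (auto intro!: derivative_eq_intros simp: field_simps power2_eq_square)
    then show "\<exists>y. ((\<lambda>u. (u - 1 / u) / 2 - ln u) has_real_derivative y) (at x) \<and> 0 \<le> y"
      by force
  qed
  then show ?thesis by simp
qed

text \<open>With \<open>u = (1 - p) / p\<close>, the difference of the two sides is
  \<open>p * h u\<close>. The function \<open>h\<close> vanishes at 1 and increases, and
  \<open>p <= 1 / 2\<close> means \<open>u >= 1\<close>.\<close>

lemma entropy_halves_le:
  fixes p :: real
  assumes "0 < p" "p \<le> 1 / 2"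
  shows "- ((1 - p) * ln (1 - p)) \<le> - (p * ln p)"
proof -
  define h where "h = (\<lambda>u::real. ln u - (u - 1) * (ln (u + 1) - ln u))"
  define u where "u = (1 - p) / p"
  have u: "1 \<le> u" using assms by (simp add: u_def field_simps)
  have "h 1 \<le> h u"
  proof (rule DERIV_nonneg_imp_nondecreasing[OF u])
    fix x :: real assume x: "1 \<le> x" "x \<le> u"
    have "(h has_real_derivative (1 / x - ((ln (x + 1) - ln x) + (x - 1) * (1 / (x + 1) - 1 / x)))) (at x)"
      unfolding h_def using x by (auto intro!: derivative_eq_intros)
    moreover have "ln (x + 1) - ln x \<le> 1 / x"
      using ln_le_minus_one[of "(x + 1) / x"] x by (simp add: ln_div field_simps)
    moreover have "(x - 1) * (1 / (x + 1) - 1 / x) \<le> 0"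
      using x by (intro mult_nonneg_nonpos) (auto simp: field_simps)
    ultimately show "\<exists>y. (h has_real_derivative y) (at x) \<and> 0 \<le> y"
      by force
  qed
  then have "0 \<le> h u" by (simp add: h_def)
  moreover have "u + 1 = 1 / p" "u - 1 = (1 - 2 * p) / p"
    using assms by (auto simp: u_def field_simps)
  moreover have "ln u = ln (1 - p) - ln p" "ln (1 / p) = - ln p"
    using assms by (auto simp: u_def ln_div)
  ultimately have "0 \<le> p * (ln (1 - p) - ln p - (1 - 2 * p) / p * (- ln p - (ln (1 - p) - ln p)))"
    using assms by (simp add: h_def)
  also have "\<dots> = (1 - p) * ln (1 - p) - p * ln p"
    using assms by (simp add: field_simps)
  finally show ?thesis by simp
qed

text \<open>The gap is the entropy of the coin \<open>q\<close> minus its chord through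
  \<open>q = p\<close> and \<open>q = 1\<close>: the subtracted term is affine in \<open>q\<close>,
  equals the entropy at \<open>p\<close> and vanishes at 1.\<close>

lemma kl_gap_eq:
  assumes "0 < p" "p < 1" "0 < q" "q < 1"
  shows "ln (1 / p) * (q - p) / (1 - p) - kl q p =
    - (q * ln q) - (1 - q) * ln (1 - q) - (1 - q) * (p * ln (1 / p) / (1 - p) - ln (1 - p))"
proof -
  have "ln (1 / p) * (q - p) / (1 - p) - q * ln (1 / p) = - ((1 - q) * (p * ln (1 / p) / (1 - p)))"
    using assms by (simp add: field_simps)
  then show ?thesis
    using assms by (simp add: kl_def ln_div algebra_simps)
qed

text \<open>The entropy term \<open>- (1 - q) ln (1 - q)\<close> dominates, because
  \<open>- ln (1 - q) >= 2\<close>, while the chord is at most \<open>1 + 7 / 10\<close> times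
  \<open>1 - q\<close>.\<close>

lemma kl_gap_near_1:
  assumes "0 < p" "p \<le> 1 / 2" "9 / 10 \<le> q" "q < 1"
  shows "phi (1 - q) / 25 \<le> ln (1 / p) * (q - p) / (1 - p) - kl q p"
proof -
  define y where "y = - ln (1 - q)"
  have "ln (8::real) = 3 * ln 2"
    using ln_realpow[of 2 3] by simp
  then have "2 \<le> ln (8::real)"
    using ln2_ge_two_thirds by simp
  also have "\<dots> \<le> ln (1 / (1 - q))"
    using assms by (simp add: field_simps)
  finally have y: "2 \<le> y"
    using assms by (simp add: y_def ln_div)
  have "- (p * ln p) \<le> 1 / 2 - p - p * ln (1 / 2)"
    using phi_tangent[of "1 / 2" p] assms by (simp add: phi_def algebra_simps)
  also have "\<dots> = 1 / 2 - p * (1 - ln 2)"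
    by (simp add: ln_div algebra_simps)
  also have "\<dots> \<le> 1 / 2"
    using assms ln2_le_25_over_36 by simp
  finally have "p * ln (1 / p) / (1 - p) \<le> 1"
    using assms by (simp add: ln_div field_simps)
  moreover have "- ln (1 - p) \<le> - ln (1 / 2)"
    using assms by simp
  then have "- ln (1 - p) \<le> 7 / 10"
    using ln2_le_25_over_36 by (simp add: ln_div)
  ultimately have "(1 - q) * (p * ln (1 / p) / (1 - p) - ln (1 - p)) \<le> (1 - q) * (17 / 10)"
    using assms by (intro mult_left_mono) linarith+
  moreover have "q * (1 - q) \<le> q * - ln q"
    using assms ln_le_minus_one[of q] by (intro mult_left_mono) auto
  moreover have "9 / 10 * (1 - q) \<le> q * (1 - q)"
    using assms by (intro mult_right_mono) auto
  moreover have "(1 - q) * y = - ((1 - q) * ln (1 - q))" "q * - ln q = - (q * ln q)"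
    by (simp_all add: y_def)
  ultimately have "9 / 10 * (1 - q) + (1 - q) * y - (1 - q) * (17 / 10)
      \<le> ln (1 / p) * (q - p) / (1 - p) - kl q p"
    using kl_gap_eq[of p q] assms by linarith
  moreover have "(1 - q) * ((1 + y) / 25) \<le> (1 - q) * (y - 8 / 10)"
    using y assms by (intro mult_left_mono) auto
  moreover have "phi (1 - q) / 25 = (1 - q) * ((1 + y) / 25)"
    by (simp add: phi_def y_def)
  moreover have "(1 - q) * (y - 8 / 10) = 9 / 10 * (1 - q) + (1 - q) * y - (1 - q) * (17 / 10)"
    by (simp add: field_simps)
  ultimately show ?thesis
    by linarith
qed

text \<open>Two uses of \<open>ln t <= t - 1\<close> reduce the gap to
  \<open>y (q - p) / (1 - p)\<close> with \<open>y = - ln q\<close>. The bounds on \<open>q\<close>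
  give \<open>q - p >= 4 q / 9\<close> and \<open>y >= 1 / 10\<close>.\<close>

lemma kl_gap_above:
  assumes "0 < p" "p \<le> 1 / 2" "9 * p / 5 \<le> q" "q \<le> 9 / 10"
  shows "phi q / 25 \<le> ln (1 / p) * (q - p) / (1 - p) - kl q p"
proof -
  have q: "0 < q" "p < q" "q < 1" using assms by auto
  define y where "y = - ln q"
  have y: "1 / 10 \<le> y"
    using ln_le_minus_one[of q] assms q by (simp add: y_def)
  have "p * (ln q - ln p) \<le> p * (q / p - 1)"
    using ln_le_minus_one[of "q / p"] assms q by (intro mult_left_mono) (auto simp: ln_div)
  also have "\<dots> = q - p"
    using assms by (simp add: field_simps)
  finally have "p * ln (1 / p) \<le> p * y + (q - p)"
    using assms q by (simp add: y_def ln_div algebra_simps)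
  then have 1: "(1 - q) * (p * ln (1 / p) / (1 - p)) \<le> (1 - q) * ((p * y + (q - p)) / (1 - p))"
    using assms q by (intro mult_left_mono divide_right_mono) auto
  have "(1 - q) * ((q - p) / (1 - p)) \<le> (1 - q) * (ln (1 - p) - ln (1 - q))"
    using ln_ge_one_minus_inverse[of "(1 - p) / (1 - q)"] assms q
    by (intro mult_left_mono) (auto simp: ln_div field_simps)
  with 1 have "q * y + (1 - q) * ((q - p) / (1 - p)) - (1 - q) * ((p * y + (q - p)) / (1 - p))
      \<le> ln (1 / p) * (q - p) / (1 - p) - kl q p"
    using kl_gap_eq[of p q] assms q by (simp add: y_def algebra_simps)
  also have "q * y + (1 - q) * ((q - p) / (1 - p)) - (1 - q) * ((p * y + (q - p)) / (1 - p))
      = y * ((q - p) / (1 - p))"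
    using assms by (simp add: divide_simps) algebra
  finally have "y * ((q - p) / (1 - p)) \<le> ln (1 / p) * (q - p) / (1 - p) - kl q p" .
  moreover have "(q - p) * 1 \<le> (q - p) * (1 / (1 - p))"
    using assms q by (intro mult_left_mono) (auto simp: field_simps)
  then have "q - p \<le> (q - p) / (1 - p)"
    by simp
  then have "4 / 9 * q \<le> (q - p) / (1 - p)"
    using assms by linarith
  then have "y * (4 / 9 * q) \<le> y * ((q - p) / (1 - p))"
    using y by (intro mult_left_mono) auto
  \<comment> \<open>The constant 25 is nearly sharp here: \<open>y >= 1 / 10\<close> gives
    \<open>1 + y <= 11 y\<close>, and \<open>11 / 25 <= 4 / 9\<close>.\<close>
  moreover have "q * ((1 + y) / 25) \<le> q * (4 / 9 * y)"
    using y q by (intro mult_left_mono) auto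
  moreover have "phi q / 25 = q * ((1 + y) / 25)" "q * (4 / 9 * y) = y * (4 / 9 * q)"
    by (simp_all add: phi_def y_def)
  ultimately show ?thesis
    by linarith
qed

text \<open>If \<open>ln (1 / p) >= 2\<close>, the linear gain alone outweighs
  \<open>kl q p <= (p - q) / (1 - p)\<close>. Otherwise \<open>ln (1 / p)\<close> may be below 1,
  and the gap comes from \<open>- q ln q\<close>, which exceeds \<open>q ln (1 / p)\<close> by at
  least \<open>q ln 2\<close>.\<close>

lemma kl_gap_below:
  assumes "0 < p" "p \<le> 1 / 2" "0 < q" "q \<le> p / 2"
  shows "phi q / 25 \<le> ln (1 / p) * (p - q) / (1 - p) - kl q p"
proof (cases "2 \<le> ln (1 / p)")
  case True
  define L where "L = ln (1 / p)"
  have "q * ln (q / p) \<le> 0"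
    using assms by (intro mult_nonneg_nonpos) auto
  moreover have "(1 - q) * ln ((1 - q) / (1 - p)) \<le> 1 * ((p - q) / (1 - p))"
    using assms ln_le_minus_one[of "(1 - q) / (1 - p)"]
    by (intro mult_mono) (auto simp: field_simps)
  moreover have "(L - 1) * ((p - q) / (1 - p)) = L * (p - q) / (1 - p) - 1 * ((p - q) / (1 - p))"
    by (simp only: left_diff_distrib times_divide_eq_right[symmetric])
  ultimately have "(L - 1) * ((p - q) / (1 - p)) \<le> L * (p - q) / (1 - p) - kl q p"
    unfolding kl_def by linarith
  moreover have "p / 2 \<le> p - q"
    using assms by simp
  then have "p / 2 \<le> (p - q) / (1 - p)"
    using assms by (simp add: field_simps) (smt (verit) mult_nonneg_nonneg)
  then have "(L - 1) * (p / 2) \<le> (L - 1) * ((p - q) / (1 - p))"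
    using True by (intro mult_left_mono) (auto simp: L_def)
  moreover have "phi q \<le> phi p"
    using assms by (intro phi_mono) auto
  moreover have "phi p / 25 = p * ((1 + L) / 25)" "(L - 1) * (p / 2) = p * ((L - 1) / 2)"
    using assms by (simp_all add: phi_def L_def ln_div)
  moreover have "p * ((1 + L) / 25) \<le> p * ((L - 1) / 2)"
    using True assms by (intro mult_left_mono) (auto simp: L_def)
  ultimately show ?thesis
    unfolding L_def by linarith
next
  case False
  define L where "L = ln (1 / p)"
  define y where "y = - ln q"
  have L: "L < 2" using False by (simp add: L_def)
  have "ln (2 / p) \<le> ln (1 / q)"
    using assms by (simp add: field_simps)
  then have y: "L + ln 2 \<le> y"
    using assms by (simp add: y_def L_def ln_div)
  have q: "q < 1" using assms by auto
  have eq: "L * (p - q) / (1 - p) - kl q p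
      = q * y - (1 - q) * ln (1 - q) + (L * (p - q) / (1 - p) - q * L + (1 - q) * ln (1 - p))"
    using assms q by (simp add: kl_def L_def y_def ln_div algebra_simps)
  txt \<open>The last bracket is affine in \<open>q\<close> and nonnegative at \<open>q = 0\<close>, so it is bounded below by
    linear interpolation from \<open>q = p\<close>.\<close>
  have "0 \<le> p * L + (1 - p) * ln (1 - p)"
    using entropy_halves_le[of p] assms by (simp add: L_def ln_div)
  then have "0 \<le> (1 - q / p) * ((p * L + (1 - p) * ln (1 - p)) / (1 - p))"
    using assms by (intro mult_nonneg_nonneg divide_nonneg_nonneg) auto
  also have "\<dots> = (L * (p - q) / (1 - p) - q * L + (1 - q) * ln (1 - p))
      + q / p * (p * L - (1 - p) * ln (1 - p))"
    using assms by (simp add: divide_simps) algebra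
  finally have 1: "- (q / p * (p * L - (1 - p) * ln (1 - p)))
      \<le> L * (p - q) / (1 - p) - q * L + (1 - q) * ln (1 - p)"
    by simp
  have "- ((1 - p) * ln (1 - p)) \<le> p"
    using mult_left_mono[OF ln_ge_one_minus_inverse[of "1 - p"], of "1 - p"] assms
    by (simp add: algebra_simps)
  then have "q / p * (p * L - (1 - p) * ln (1 - p)) \<le> q / p * (p * L + p)"
    using assms by (intro mult_left_mono) auto
  also have "\<dots> = q * (L + 1)"
    using assms by (simp add: field_simps)
  finally have 2: "- (q * (L + 1)) \<le> L * (p - q) / (1 - p) - q * L + (1 - q) * ln (1 - p)"
    using 1 by linarith
  have "(1 - q) * q \<le> (1 - q) * - ln (1 - q)"
    using ln_le_minus_one[of "1 - q"] q by (intro mult_left_mono) auto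
  then have "q * y + (1 - q) * q - q * (L + 1) \<le> L * (p - q) / (1 - p) - kl q p"
    using 2 eq by simp
  also have "q * y + (1 - q) * q - q * (L + 1) = q * (y - L - q)"
    by (simp add: algebra_simps)
  finally have "q * (y - L - q) \<le> L * (p - q) / (1 - p) - kl q p" .
  moreover have "q * ((1 + y) / 25) \<le> q * (y - L - q)"
    using assms y L ln2_ge_two_thirds by (intro mult_left_mono) auto
  moreover have "phi q / 25 = q * ((1 + y) / 25)"
    by (simp add: phi_def y_def)
  ultimately show ?thesis
    unfolding L_def by linarith
qed

text \<open>\<open>kl\<close> vanishes to second order at \<open>q = p\<close>, so close to
  \<open>p\<close> it is a proper fraction of the linear gain. The intermediate factor 3/5 fits
  because \<open>ln (1 / p) >= ln 2 >= 2 / 3\<close>.\<close>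

lemma kl_le_linear:
  assumes "0 < p" "p \<le> 1 / 2" "p / 2 \<le> q" "q \<le> 9 * p / 5"
  shows "kl q p \<le> 9 / 10 * (ln (1 / p) * \<bar>q - p\<bar> / (1 - p))"
proof -
  have q: "0 < q" "q < 1" using assms by auto
  have "ln 2 \<le> ln (1 / p)"
    using assms by (simp add: field_simps)
  then have L: "3 / 5 \<le> 9 / 10 * ln (1 / p)"
    using ln2_ge_two_thirds by simp
  have 1: "(1 - q) * ln ((1 - q) / (1 - p)) \<le> (1 - q) * ((p - q) / (1 - p))"
    using assms q ln_le_minus_one[of "(1 - q) / (1 - p)"]
    by (intro mult_left_mono) (auto simp: field_simps)
  have "kl q p \<le> 3 / 5 * (\<bar>q - p\<bar> / (1 - p))"
  proof (cases "p \<le> q")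
    case True
    have "q * ln (q / p) \<le> q * ((q / p - 1 / (q / p)) / 2)"
      using ln_le_half_diff_inverse[of "q / p"] assms True q by (intro mult_left_mono) auto
    also have "\<dots> = (q - p) * ((q / p + 1) / 2)"
      using assms q by (simp add: field_simps)
    also have "\<dots> \<le> (q - p) * (7 / 5)"
      using assms True by (intro mult_left_mono) (auto simp: field_simps)
    finally have "kl q p \<le> (q - p) * (7 / 5) + (1 - q) * ((p - q) / (1 - p))"
      using 1 unfolding kl_def by linarith
    also have "\<dots> = (7 / 5 * (1 - p) - (1 - q)) * ((q - p) / (1 - p))"
      using assms by (simp add: field_simps)
    also have "\<dots> \<le> 3 / 5 * ((q - p) / (1 - p))"
    proof (rule mult_right_mono)
      \<comment> \<open>By \<open>q <= 9 p / 5\<close> the left side is at most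
        \<open>2 / 5 + 2 p / 5\<close>, which reaches 3/5 at \<open>p = 1 / 2\<close>.\<close>
      show "7 / 5 * (1 - p) - (1 - q) \<le> 3 / 5"
        using assms by (simp add: field_simps)
    qed (use assms True in simp)
    finally show ?thesis using True by simp
  next
    case False
    have "q * ln (q / p) \<le> q * (q / p - 1)"
      using assms q ln_le_minus_one[of "q / p"] by (intro mult_left_mono) auto
    then have "kl q p \<le> q * (q / p - 1) + (1 - q) * ((p - q) / (1 - p))"
      using 1 by (simp add: kl_def)
    also have "\<dots> = (1 - q / p) * ((p - q) / (1 - p))"
      using assms by (simp add: divide_simps) algebra
    also have "\<dots> \<le> 3 / 5 * ((p - q) / (1 - p))"
      using assms False by (intro mult_right_mono) (auto simp: field_simps)
    finally show ?thesis using False by simp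
  qed
  also have "\<dots> \<le> 9 / 10 * ln (1 / p) * (\<bar>q - p\<bar> / (1 - p))"
    using assms L by (intro mult_right_mono) auto
  finally show ?thesis by simp
qed

section \<open>The one-coordinate inequality\<close>

text \<open>
  Here \<open>a\<close>, \<open>b\<close>, \<open>z\<close> stand for the relative errors of the best subcubes for the sections at 1 and 0 and for
  the whole set, and \<open>x\<close> for the influence of the last coordinate divided by the measure. The bounds \<open>z1\<close>,
  \<open>z0\<close>, \<open>za\<close>, \<open>zb\<close> come from the candidate subcubes \<open>S\<^sub>1 \<times> {1}\<close>, \<open>S\<^sub>0 \<times> {0}\<close>, \<open>S\<^sub>1 \<times> {0, 1}\<close>, \<open>S\<^sub>0 \<times> {0, 1}\<close>.
\<close>

lemma deficit_step:
  assumes p: "0 < p" "p \<le> 1 / 2" and q: "0 < q" "q < 1"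
    and ab: "0 \<le> a" "a \<le> 1" "0 \<le> b" "b \<le> 1" and z: "0 \<le> z"
    and x: "\<bar>q - p\<bar> / (p * (1 - p)) \<le> x"
    and z1: "z \<le> q * a + (1 - q)" and z0: "z \<le> (1 - q) * b + q"
    and za: "z \<le> a + 2 * x" and zb: "z \<le> b + 2 * p * x"
    and rigid: "x < p / 100 \<Longrightarrow> a < p / 100 \<or> b < p / 100 \<Longrightarrow> z \<le> q * a + (1 - q) * b"
    and diff: "p / 2 \<le> q \<Longrightarrow> \<bar>a - b\<bar> \<le> 4 * x"
  shows "phi z / 1000 \<le> (q * phi a + (1 - q) * phi b) / 1000 + (ln (1 / p) * p * x - kl q p)"
proof -
  define L where "L = ln (1 / p)"
  have "ln 2 \<le> ln (1 / p)"
    using p by (simp add: field_simps)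
  then have L: "2 / 3 \<le> L"
    using ln2_ge_two_thirds by (simp add: L_def)
  have pq: "p < 1" "q \<le> 1" using p q by auto
  have phi_ab: "0 \<le> q * phi a" "0 \<le> (1 - q) * phi b"
    using q ab by (auto intro!: mult_nonneg_nonneg phi_nonneg)
  have "q * a + (1 - q) \<le> q * 1 + (1 - q)"
    using q ab by (intro add_right_mono mult_left_mono) auto
  then have c1: "q * a + (1 - q) \<le> 1"
    by simp
  then have z_le_1: "z \<le> 1"
    using z1 by simp
  have "(1 - q) * b + q \<le> (1 - q) * 1 + q"
    using q ab by (intro add_right_mono mult_left_mono) auto
  then have c0: "(1 - q) * b + q \<le> 1"
    by simp
  have x_nonneg: "0 \<le> x"
  proof -
    have "0 \<le> \<bar>q - p\<bar> / (p * (1 - p))"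
      using p by (intro divide_nonneg_nonneg mult_nonneg_nonneg) auto
    then show ?thesis using x by linarith
  qed
  have "L * p * (\<bar>q - p\<bar> / (p * (1 - p))) \<le> L * p * x"
    using x L p by (intro mult_left_mono) auto
  also have "L * p * (\<bar>q - p\<bar> / (p * (1 - p))) = L * \<bar>q - p\<bar> / (1 - p)"
    using p by (simp add: field_simps)
  finally have iota: "L * \<bar>q - p\<bar> / (1 - p) \<le> L * p * x" .
  \<comment> \<open>Far from \<open>p\<close> a section is discarded: \<open>z1\<close> keeps the
    section at 1 for \<open>high\<close>, \<open>z0\<close> the section at 0 for
    \<open>above\<close> and \<open>below\<close>. The loss \<open>2 phi / 1000\<close> is covered
    by the gain \<open>phi / 25\<close>. The bounds \<open>za\<close>, \<open>zb\<close>,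
    \<open>rigid\<close> and \<open>diff\<close> serve the case \<open>near\<close>.\<close>
  consider (high) "9 / 10 \<le> q" | (above) "9 * p / 5 \<le> q" "q \<le> 9 / 10" | (below) "q \<le> p / 2"
    | (near) "p / 2 \<le> q" "q \<le> 9 * p / 5"
    by linarith
  then show ?thesis
  proof cases
    case high
    have "\<bar>q - p\<bar> = q - p"
      using high p q by auto
    then have "L * (q - p) / (1 - p) \<le> L * p * x"
      using iota by simp
    then have "phi (1 - q) / 25 \<le> L * p * x - kl q p"
      using kl_gap_near_1[of p q] high p q unfolding L_def by linarith
    moreover have "phi z \<le> phi (q * a + (1 - q))"
      using z z1 c1 by (intro phi_mono) auto
    moreover have "phi (q * a + (1 - q)) \<le> q * phi a + 2 * phi (1 - q)"
      using phi_convex_split q ab by blast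
    moreover have "0 \<le> phi (1 - q)"
      using q by (intro phi_nonneg) auto
    ultimately show ?thesis
      using phi_ab unfolding L_def add_divide_distrib by linarith
  next
    case near
    have "kl q p \<le> 9 / 10 * (L * \<bar>q - p\<bar> / (1 - p))"
      using kl_le_linear[of p q] near p by (simp add: L_def)
    \<comment> \<open>One tenth of the influence term survives, so after the factor 1/1000 any
      increase of \<open>phi\<close> by at most \<open>100 L p x\<close> is absorbed.\<close>
    then have gap: "L * p * x / 10 \<le> L * p * x - kl q p"
      using iota by linarith
    show ?thesis
    proof (cases "x < p / 100 \<and> (a < p / 100 \<or> b < p / 100)")
      case True
      then have "z \<le> q * a + (1 - q) * b"
        using rigid by blast
      moreover have "q * a + (1 - q) * b \<le> 1"
        using q ab by (intro convex_bound_le) auto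
      ultimately have "phi z \<le> phi (q * a + (1 - q) * b)"
        using z by (intro phi_mono) auto
      also have "\<dots> \<le> q * phi a + (1 - q) * phi b + \<bar>a - b\<bar> * (q * (1 + ln (1 / q)))"
        using phi_jensen_gap q ab by blast
      also have "\<bar>a - b\<bar> * (q * (1 + ln (1 / q))) \<le> (4 * x) * (9 * p / 5 * (4 * L))"
      proof (intro mult_mono)
        have "1 / q \<le> 2 / p"
          using near p q by (simp add: field_simps)
        then have "ln (1 / q) \<le> ln (2 / p)"
          using p q by (intro ln_mono) auto
        also have "\<dots> = ln 2 + L"
          using p by (simp add: L_def ln_div)
        finally show "1 + ln (1 / q) \<le> 4 * L"
          using L ln2_le_25_over_36 by linarith
      qed (use diff near q p x_nonneg in auto)
      also have "\<dots> \<le> 100 * (L * p * x)"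
        using p L x_nonneg by (simp add: mult_nonneg_nonneg)
      finally show ?thesis
        using gap unfolding L_def add_divide_distrib by linarith
    next
      case False
      \<comment> \<open>Here \<open>x >= p / 100\<close>, or both \<open>a\<close> and
        \<open>b\<close> are at least \<open>p / 100\<close>. In the first case \<open>t\<close> is
        below the increments \<open>2 x\<close> and \<open>2 p x\<close>, in the second below both
        errors, and \<open>ln (1 / t)\<close> is still of order \<open>L\<close>.\<close>
      define t where "t = p\<^sup>2 / 100"
      have "p * p \<le> (1 / 2) * (1 / 2)"
        using p by (intro mult_mono) auto
      then have t: "0 < t" "t \<le> 1 / 2" "t \<le> p / 100"
        using p by (simp_all add: t_def power2_eq_square)
      have "ln (128 :: real) = 7 * ln 2"
        using ln_realpow[of 2 7] by simp
      moreover have "ln (100 :: real) \<le> ln 128"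
        by simp
      moreover have "ln (1 / t) = ln 100 + 2 * L"
        using p by (simp add: t_def L_def ln_div ln_realpow)
      ultimately have B: "1 + ln (1 / t) \<le> 12 * L"
        using ln2_le_25_over_36 L by linarith
      have ta: "t \<le> a \<or> t \<le> 2 * x" and tb: "t \<le> b \<or> t \<le> 2 * p * x"
      proof -
        have "t \<le> 2 * p * x" if "p / 100 \<le> x"
        proof -
          have "p * (p / 100) \<le> p * x" "0 \<le> p * x"
            using that p x_nonneg by (auto intro: mult_left_mono)
          then show ?thesis by (simp add: t_def power2_eq_square)
        qed
        then show "t \<le> b \<or> t \<le> 2 * p * x"
          using False t by linarith
        show "t \<le> a \<or> t \<le> 2 * x"
          using False t by linarith
      qed
      \<comment> \<open>\<open>phi z\<close> is split with weights \<open>q\<close> and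
        \<open>1 - q\<close>. Comparison with \<open>a\<close> costs order \<open>L x\<close> but
        has weight \<open>q <= 9 p / 5\<close>; comparison with \<open>b\<close> already costs only
        order \<open>L p x\<close>.\<close>
      have "phi z \<le> phi a + 2 * x * (1 + ln (1 / t))"
        using phi_increment[OF _ _ _ _ _ ta] ab x_nonneg t z z_le_1 za by simp
      also have "2 * x * (1 + ln (1 / t)) \<le> 2 * x * (12 * L)"
        using B x_nonneg by (intro mult_left_mono) auto
      finally have "q * phi z \<le> q * (phi a + 2 * x * (12 * L))"
        using q by (intro mult_left_mono) auto
      moreover have "q * (24 * (x * L)) \<le> 9 * p / 5 * (24 * (x * L))"
        using near x_nonneg L by (intro mult_right_mono) auto
      moreover have Lpx: "0 \<le> L * p * x"
        using p L x_nonneg by simp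
      moreover have "9 * p / 5 * (24 * (x * L)) = 216 / 5 * (L * p * x)"
        "q * (phi a + 2 * x * (12 * L)) = q * phi a + q * (24 * (x * L))"
        by (simp_all add: algebra_simps)
      ultimately have 1: "q * phi z \<le> q * phi a + 48 * (L * p * x)"
        by linarith
      have "phi z \<le> phi b + 2 * p * x * (1 + ln (1 / t))"
        using phi_increment[OF _ _ _ _ _ tb] ab p x_nonneg t z z_le_1 zb by simp
      also have "2 * p * x * (1 + ln (1 / t)) \<le> 2 * p * x * (12 * L)"
        using B x_nonneg p by (intro mult_left_mono) auto
      finally have "(1 - q) * phi z \<le> (1 - q) * (phi b + 2 * p * x * (12 * L))"
        using q by (intro mult_left_mono) auto
      also have "\<dots> \<le> (1 - q) * phi b + 24 * (L * p * x)"
      proof -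
        have "(1 - q) * (24 * (L * p * x)) \<le> 1 * (24 * (L * p * x))"
          using q p L x_nonneg by (intro mult_right_mono) auto
        then show ?thesis by (simp add: algebra_simps)
      qed
      finally have "phi z \<le> q * phi a + (1 - q) * phi b + 72 * (L * p * x)"
        using 1 by (simp add: algebra_simps)
      then show ?thesis
        using gap Lpx unfolding L_def add_divide_distrib by linarith
    qed
  next
    case above
    have "\<bar>q - p\<bar> = q - p"
      using above p q by auto
    then have "L * (q - p) / (1 - p) \<le> L * p * x"
      using iota by simp
    then have "phi q / 25 \<le> L * p * x - kl q p"
      using kl_gap_above[of p q] above p q unfolding L_def by linarith
    moreover have "phi z \<le> phi ((1 - q) * b + q)"
      using z z0 c0 by (intro phi_mono) auto
    moreover have "phi ((1 - q) * b + q) \<le> (1 - q) * phi b + 2 * phi q"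
      using phi_convex_split[of "1 - q" b] q ab by simp
    moreover have "0 \<le> phi q"
      using q by (intro phi_nonneg) auto
    ultimately show ?thesis
      using phi_ab unfolding L_def add_divide_distrib by linarith
  next
    case below
    have "\<bar>q - p\<bar> = p - q"
      using below p q by auto
    then have "L * (p - q) / (1 - p) \<le> L * p * x"
      using iota by simp
    then have "phi q / 25 \<le> L * p * x - kl q p"
      using kl_gap_below[of p q] below p q unfolding L_def by linarith
    moreover have "phi z \<le> phi ((1 - q) * b + q)"
      using z z0 c0 by (intro phi_mono) auto
    moreover have "phi ((1 - q) * b + q) \<le> (1 - q) * phi b + 2 * phi q"
      using phi_convex_split[of "1 - q" b] q ab by simp
    moreover have "0 \<le> phi q"
      using q by (intro phi_nonneg) auto
    ultimately show ?thesis
      using phi_ab unfolding L_def add_divide_distrib by linarith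
  qed
qed

section \<open>Sections and cylinders in the cube\<close>

definition sdiff :: "'a set \<Rightarrow> 'a set \<Rightarrow> 'a set" where
  "sdiff A B = (A - B) \<union> (B - A)"

definition sect :: "nat \<Rightarrow> nat \<Rightarrow> (nat \<Rightarrow> nat) set \<Rightarrow> (nat \<Rightarrow> nat) set" where
  "sect n b A = {x \<in> cube n. x(Suc n := b) \<in> A}"

definition cyl :: "nat \<Rightarrow> nat set \<Rightarrow> (nat \<Rightarrow> nat) set \<Rightarrow> (nat \<Rightarrow> nat) set" where
  "cyl n B S = (\<lambda>(x, b). x(Suc n := b)) ` (S \<times> B)"

definition set_influence :: "nat \<Rightarrow> real \<Rightarrow> (nat \<Rightarrow> nat) set \<Rightarrow> real" where
  "set_influence n p A =
     (\<Sum>i\<in>{1..n}. biased_measure n p {x \<in> cube n. (x \<in> A) \<noteq> (flip_coord x i \<in> A)})"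

text \<open>The slack in \<open>p I >= m log_p m\<close>, multiplied by \<open>ln (1 / p)\<close> to
  pass to natural logarithms.\<close>

definition deficit :: "nat \<Rightarrow> real \<Rightarrow> (nat \<Rightarrow> nat) set \<Rightarrow> real" where
  "deficit n p A = ln (1 / p) * p * set_influence n p A + biased_measure n p A * ln (biased_measure n p A)"

section \<open>The cube and the biased measure when a coordinate is added\<close>

lemma finite_cube [simp]: "finite (cube n)"
  by (simp add: cube_def finite_PiE)

lemma cube_0: "cube 0 = {\<lambda>_. undefined}"
  by (simp add: cube_def)

lemma cube_out: "x \<in> cube n \<Longrightarrow> x (Suc n) = undefined"
  by (auto simp: cube_def PiE_def extensional_def)

lemma cube_val: "x \<in> cube n \<Longrightarrow> i \<in> {1..n} \<Longrightarrow> x i = 0 \<or> x i = 1"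
  by (auto simp: cube_def)

lemma cube_Suc: "cube (Suc n) = cyl n {0, 1} (cube n)"
proof -
  have "{1..Suc n} = insert (Suc n) {1..n}"
    by auto
  then show ?thesis
    by (auto simp: cube_def cyl_def PiE_insert_eq image_iff)
qed

lemma mem_cyl: "y \<in> cyl n B S \<longleftrightarrow> (\<exists>x\<in>S. \<exists>b\<in>B. y = x(Suc n := b))"
  by (auto simp: cyl_def)

lemma upd_in_cube_Suc: "x \<in> cube n \<Longrightarrow> b \<in> {0, 1} \<Longrightarrow> x(Suc n := b) \<in> cube (Suc n)"
  unfolding cube_Suc cyl_def by (rule image_eqI[where x = "(x, b)"]) auto

lemma upd_eq_iff:
  assumes "x \<in> cube n" "y \<in> cube n"
  shows "x(Suc n := b) = y(Suc n := c) \<longleftrightarrow> x = y \<and> b = c"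
  using cube_out[OF assms(1)] cube_out[OF assms(2)]
  by (metis fun_upd_same fun_upd_triv fun_upd_upd)

lemma sum_cube_Suc:
  "(\<Sum>x\<in>cube (Suc n). h x) = (\<Sum>x\<in>cube n. h (x(Suc n := 1)) + h (x(Suc n := 0)))"
    for h :: "(nat \<Rightarrow> nat) \<Rightarrow> real"
proof -
  have inj: "inj_on (\<lambda>(x, b). x(Suc n := b)) (cube n \<times> {0, 1::nat})"
    by (auto simp: inj_on_def upd_eq_iff)
  have "(\<Sum>x\<in>cube (Suc n). h x) = (\<Sum>(x, b)\<in>cube n \<times> {0, 1}. h (x(Suc n := b)))"
    unfolding cube_Suc cyl_def by (subst sum.reindex[OF inj]) (simp add: case_prod_unfold)
  also have "\<dots> = (\<Sum>x\<in>cube n. \<Sum>b\<in>{0, 1}. h (x(Suc n := b)))"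
    by (simp only: sum.cartesian_product)
  finally show ?thesis by (simp add: add.commute)
qed

lemma biased_mass_Suc:
  assumes "x \<in> cube n"
  shows "biased_mass (Suc n) p (x(Suc n := 1)) = p * biased_mass n p x"
    and "biased_mass (Suc n) p (x(Suc n := 0)) = (1 - p) * biased_mass n p x"
proof -
  \<comment> \<open>This bound makes the natural-number subtraction in the exponent exact.\<close>
  have "(\<Sum>i\<in>{1..n}. x i) \<le> (\<Sum>i\<in>{1..n}. 1)"
    using cube_val[OF assms] by (intro sum_mono) force
  then have "(\<Sum>i\<in>{1..n}. x i) \<le> n" by simp
  then show "biased_mass (Suc n) p (x(Suc n := 1)) = p * biased_mass n p x"
    and "biased_mass (Suc n) p (x(Suc n := 0)) = (1 - p) * biased_mass n p x"
    by (simp_all add: biased_mass_def Suc_diff_le)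
qed

lemma biased_measure_alt: "biased_measure n p A = (\<Sum>x\<in>cube n. biased_mass n p x * of_bool (x \<in> A))"
proof -
  have "biased_measure n p A = (\<Sum>x\<in>cube n. if x \<in> A then biased_mass n p x else 0)"
    unfolding biased_measure_def by (subst Int_commute) (rule sum.inter_restrict, simp)
  then show ?thesis by (simp add: if_distrib[where f = "\<lambda>t. _ * t"] of_bool_def cong: if_cong)
qed

lemma biased_measure_Suc:
  "biased_measure (Suc n) p A =
     p * biased_measure n p (sect n 1 A) + (1 - p) * biased_measure n p (sect n 0 A)"
  unfolding biased_measure_alt sum_cube_Suc sum_distrib_left sum.distrib[symmetric]
  by (rule sum.cong) (auto simp: sect_def biased_mass_Suc[simplified] algebra_simps)

lemma biased_mass_nonneg: "0 \<le> p \<Longrightarrow> p \<le> 1 \<Longrightarrow> 0 \<le> biased_mass n p x"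
  by (simp add: biased_mass_def)

lemma biased_mass_pos: "0 < p \<Longrightarrow> p < 1 \<Longrightarrow> 0 < biased_mass n p x"
  by (simp add: biased_mass_def)

lemma biased_measure_empty [simp]: "biased_measure n p {} = 0"
  by (simp add: biased_measure_def)

lemma biased_measure_nonneg: "0 \<le> p \<Longrightarrow> p \<le> 1 \<Longrightarrow> 0 \<le> biased_measure n p A"
  unfolding biased_measure_def by (intro sum_nonneg biased_mass_nonneg)

lemma biased_measure_pos:
  "0 < p \<Longrightarrow> p < 1 \<Longrightarrow> A \<subseteq> cube n \<Longrightarrow> A \<noteq> {} \<Longrightarrow> 0 < biased_measure n p A"
  unfolding biased_measure_def
  by (intro sum_pos biased_mass_pos) (auto intro: finite_subset)

lemma biased_measure_mono:
  "0 \<le> p \<Longrightarrow> p \<le> 1 \<Longrightarrow> A \<subseteq> B \<Longrightarrow> biased_measure n p A \<le> biased_measure n p B"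
  unfolding biased_measure_def by (intro sum_mono2 biased_mass_nonneg) auto

lemma biased_measure_Un_le:
  assumes "0 \<le> p" "p \<le> 1"
  shows "biased_measure n p (A \<union> B) \<le> biased_measure n p A + biased_measure n p B"
  unfolding biased_measure_alt sum.distrib[symmetric]
  using biased_mass_nonneg[OF assms] by (intro sum_mono) auto

lemma biased_measure_sdiff_triangle:
  assumes "0 \<le> p" "p \<le> 1"
  shows "biased_measure n p (sdiff A C) \<le> biased_measure n p (sdiff A B) + biased_measure n p (sdiff B C)"
  by (rule order_trans[OF biased_measure_mono biased_measure_Un_le])
     (use assms in \<open>auto simp: sdiff_def\<close>)

lemma biased_measure_le_sdiff:
  assumes "0 \<le> p" "p \<le> 1"
  shows "biased_measure n p A \<le> biased_measure n p B + biased_measure n p (sdiff A B)"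
  by (rule order_trans[OF biased_measure_mono biased_measure_Un_le])
     (use assms in \<open>auto simp: sdiff_def\<close>)

section \<open>Symmetric differences, sections and influence\<close>

lemma sdiff_commute: "sdiff A B = sdiff B A"
  by (auto simp: sdiff_def)

lemma sdiff_self [simp]: "sdiff A A = {}"
  by (simp add: sdiff_def)

lemma sdiff_empty [simp]: "sdiff A {} = A" "sdiff {} A = A"
  by (simp_all add: sdiff_def)

lemma sect_sdiff: "sect n b (sdiff A B) = sdiff (sect n b A) (sect n b B)"
  by (auto simp: sect_def sdiff_def)

lemma sect_subset: "sect n b A \<subseteq> cube n"
  by (auto simp: sect_def)

lemma sect_cyl:
  assumes "S \<subseteq> cube n"
  shows "sect n b (cyl n B S) = (if b \<in> B then S else {})"
  using assms by (auto simp: sect_def cyl_def upd_eq_iff subset_iff image_iff)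

lemma sect_nonempty:
  assumes "A \<subseteq> cube (Suc n)" "A \<noteq> {}"
  shows "sect n 0 A \<noteq> {} \<or> sect n 1 A \<noteq> {}"
  using assms unfolding cube_Suc cyl_def by (fastforce simp: sect_def)

lemma flip_coord_in_cube: "x \<in> cube n \<Longrightarrow> i \<in> {1..n} \<Longrightarrow> flip_coord x i \<in> cube n"
  using cube_val[of x n i] by (auto simp: cube_def flip_coord_def PiE_def Pi_def extensional_def)

text \<open>Flips of the first \<open>n\<close> coordinates commute with fixing the last one.
  Flipping the last one changes membership exactly where the sections differ, whichever value it
  has, so the weights \<open>p\<close> and \<open>1 - p\<close> add up to 1.\<close>

lemma set_influence_Suc:
  "set_influence (Suc n) p A = p * set_influence n p (sect n 1 A) + (1 - p) * set_influence n p (sect n 0 A)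
     + biased_measure n p (sdiff (sect n 1 A) (sect n 0 A))"
proof -
  have 1: "sect n b {x \<in> cube (Suc n). (x \<in> A) \<noteq> (flip_coord x i \<in> A)}
      = {x \<in> cube n. (x \<in> sect n b A) \<noteq> (flip_coord x i \<in> sect n b A)}"
    if "i \<in> {1..n}" "b \<in> {0, 1}" for i b
  proof -
    have "flip_coord x i \<in> cube n" if "x \<in> cube n" for x
      using flip_coord_in_cube that \<open>i \<in> {1..n}\<close> by blast
    moreover have "flip_coord (x(Suc n := b)) i = (flip_coord x i)(Suc n := b)" for x
      using that by (auto simp: flip_coord_def)
    ultimately show ?thesis
      using that upd_in_cube_Suc by (auto simp: sect_def)
  qed
  have 2: "sect n b {x \<in> cube (Suc n). (x \<in> A) \<noteq> (flip_coord x (Suc n) \<in> A)}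
      = sdiff (sect n 1 A) (sect n 0 A)" if "b \<in> {0, 1}" for b
    using that upd_in_cube_Suc[of _ n] by (auto simp: sect_def sdiff_def flip_coord_def)
  have "set_influence (Suc n) p A =
      (\<Sum>i\<in>{1..n}. biased_measure (Suc n) p {x \<in> cube (Suc n). (x \<in> A) \<noteq> (flip_coord x i \<in> A)})
      + biased_measure (Suc n) p {x \<in> cube (Suc n). (x \<in> A) \<noteq> (flip_coord x (Suc n) \<in> A)}"
    by (simp add: set_influence_def)
  also have "(\<Sum>i\<in>{1..n}. biased_measure (Suc n) p {x \<in> cube (Suc n). (x \<in> A) \<noteq> (flip_coord x i \<in> A)})
      = p * set_influence n p (sect n 1 A) + (1 - p) * set_influence n p (sect n 0 A)"
    unfolding set_influence_def sum_distrib_left sum.distrib[symmetric]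
  proof (rule sum.cong[OF refl])
    fix i assume i: "i \<in> {1..n}"
    show "biased_measure (Suc n) p {x \<in> cube (Suc n). (x \<in> A) \<noteq> (flip_coord x i \<in> A)} =
      p * biased_measure n p {x \<in> cube n. (x \<in> sect n 1 A) \<noteq> (flip_coord x i \<in> sect n 1 A)}
      + (1 - p) * biased_measure n p {x \<in> cube n. (x \<in> sect n 0 A) \<noteq> (flip_coord x i \<in> sect n 0 A)}"
      unfolding biased_measure_Suc by (subst (1 2) 1[OF i]) simp_all
  qed
  also have "biased_measure (Suc n) p {x \<in> cube (Suc n). (x \<in> A) \<noteq> (flip_coord x (Suc n) \<in> A)}
      = biased_measure n p (sdiff (sect n 1 A) (sect n 0 A))"
    unfolding biased_measure_Suc by (subst (1 2) 2) (simp_all add: algebra_simps)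
  finally show ?thesis .
qed

section \<open>Subcubes as cylinders, and their rigidity\<close>

lemma subcube_subset: "subcube n S \<Longrightarrow> S \<subseteq> cube n"
  by (auto simp: subcube_def)

lemma subcube_0: "subcube 0 S \<longleftrightarrow> S = cube 0"
  by (auto simp: subcube_def)

text \<open>Serves both to build subcubes as cylinders and to split them; the assumption isolates
  the condition on the new coordinate as \<open>b \<in> B\<close>.\<close>

lemma fixed_cube_Suc:
  assumes "\<And>x b. b \<in> {0, 1} \<Longrightarrow> (\<forall>i\<in>G. (x(Suc n := b)) i = c i) \<longleftrightarrow> b \<in> B \<and> (\<forall>i\<in>F. x i = a i)"
    and "B \<subseteq> {0, 1}"
  shows "{y \<in> cube (Suc n). \<forall>i\<in>G. y i = c i} = cyl n B {x \<in> cube n. \<forall>i\<in>F. x i = a i}"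
proof (rule set_eqI)
  fix y
  have "y \<in> {y \<in> cube (Suc n). \<forall>i\<in>G. y i = c i} \<longleftrightarrow>
      (\<exists>x\<in>cube n. \<exists>b\<in>{0, 1}. y = x(Suc n := b) \<and> (\<forall>i\<in>G. (x(Suc n := b)) i = c i))"
    unfolding cube_Suc mem_Collect_eq mem_cyl by blast
  also have "\<dots> \<longleftrightarrow>
      (\<exists>x\<in>cube n. \<exists>b\<in>{0, 1}. y = x(Suc n := b) \<and> b \<in> B \<and> (\<forall>i\<in>F. x i = a i))"
    by (intro bex_cong conj_cong refl assms(1))
  also have "\<dots> \<longleftrightarrow> y \<in> cyl n B {x \<in> cube n. \<forall>i\<in>F. x i = a i}"
    unfolding mem_cyl Bex_def mem_Collect_eq using assms(2) by blast
  finally show "y \<in> {y \<in> cube (Suc n). \<forall>i\<in>G. y i = c i} \<longleftrightarrow>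
      y \<in> cyl n B {x \<in> cube n. \<forall>i\<in>F. x i = a i}" .
qed

lemma subcube_cyl:
  assumes "subcube n S" "B \<in> {{0}, {1}, {0, 1}}"
  shows "subcube (Suc n) (cyl n B S)"
proof -
  obtain F a where F: "F \<subseteq> {1..n}" "a \<in> F \<rightarrow> {0, 1}" "S = {x \<in> cube n. \<forall>i\<in>F. x i = a i}"
    using assms by (auto simp: subcube_def)
  have upd: "(z(Suc n := b)) i = z i" if "i \<in> F" for z :: "nat \<Rightarrow> nat" and b i
    using F(1) that by auto
  show ?thesis
  proof (cases "B = {0, 1}")
    case True
    have "(\<forall>i\<in>F. (x(Suc n := b)) i = a i) \<longleftrightarrow> b \<in> B \<and> (\<forall>i\<in>F. x i = a i)" if "b \<in> {0, 1}" for x b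
      using that by (simp only: upd True simp_thms cong: ball_cong)
    then have "{y \<in> cube (Suc n). \<forall>i\<in>F. y i = a i} = cyl n B S"
      unfolding F(3) by (rule fixed_cube_Suc) (simp_all only: True order_refl)
    moreover have "F \<subseteq> {1..Suc n}"
      using F(1) by auto
    ultimately show ?thesis
      using F(2) unfolding subcube_def by (intro exI[of _ F] exI[of _ a] conjI) (simp_all only:)
  next
    case False
    then obtain c where c: "B = {c}" "c \<in> {0, 1}"
      using assms(2) by auto
    have "(\<forall>i\<in>insert (Suc n) F. (x(Suc n := b)) i = (a(Suc n := c)) i) \<longleftrightarrow> b \<in> B \<and> (\<forall>i\<in>F. x i = a i)" for x b
      by (simp only: upd c(1) ball_simps fun_upd_same singleton_iff cong: ball_cong)
    then have "{y \<in> cube (Suc n). \<forall>i\<in>insert (Suc n) F. y i = (a(Suc n := c)) i} = cyl n B S"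
      unfolding F(3) by (rule fixed_cube_Suc) (use c in auto)
    moreover have "insert (Suc n) F \<subseteq> {1..Suc n}"
      using F(1) by auto
    moreover have "a(Suc n := c) \<in> insert (Suc n) F \<rightarrow> {0, 1}"
      using F(2) c(2) by (simp add: Pi_iff)
    ultimately show ?thesis
      unfolding subcube_def
      by (intro exI[of _ "insert (Suc n) F"] exI[of _ "a(Suc n := c)"] conjI) (simp_all only:)
  qed
qed

lemma subcube_SucE:
  assumes "subcube (Suc n) S"
  obtains S' B where "subcube n S'" "B \<in> {{0}, {1}, {0, 1}}" "S = cyl n B S'"
proof -
  obtain F a where F: "F \<subseteq> {1..Suc n}" "a \<in> F \<rightarrow> {0, 1}" "S = {x \<in> cube (Suc n). \<forall>i\<in>F. x i = a i}"
    using assms by (auto simp: subcube_def)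
  define S' where "S' = {x \<in> cube n. \<forall>i\<in>F - {Suc n}. x i = a i}"
  define B where "B = (if Suc n \<in> F then {a (Suc n)} else {0, 1})"
  have "F - {Suc n} \<subseteq> {1..n}"
    using F(1) by auto
  moreover have "a \<in> F - {Suc n} \<rightarrow> {0, 1}"
    using F(2) by (simp add: Pi_iff)
  ultimately have "subcube n S'"
    unfolding subcube_def S'_def by (intro exI[of _ "F - {Suc n}"] exI[of _ a] conjI refl)
  moreover have B: "B \<in> {{0}, {1}, {0, 1}}"
    using funcset_mem[OF F(2), of "Suc n"] by (auto simp: B_def)
  moreover have "S = cyl n B S'"
  proof -
    have "(\<forall>i\<in>F. (x(Suc n := b)) i = a i) \<longleftrightarrow> b \<in> B \<and> (\<forall>i\<in>F - {Suc n}. x i = a i)"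
      if "b \<in> {0, 1}" for x b
      using that unfolding B_def by auto
    then show ?thesis
      unfolding F(3) S'_def using B by (intro fixed_cube_Suc) auto
  qed
  ultimately show ?thesis
    using that by blast
qed

lemma biased_measure_cyl:
  assumes "S \<subseteq> cube n"
  shows "biased_measure (Suc n) p (sdiff A (cyl n B S)) =
    p * biased_measure n p (sdiff (sect n 1 A) (if 1 \<in> B then S else {}))
    + (1 - p) * biased_measure n p (sdiff (sect n 0 A) (if 0 \<in> B then S else {}))"
  by (simp only: biased_measure_Suc sect_sdiff sect_cyl[OF assms])

text \<open>If both subcubes restrict the last coordinate alike, the claim is inherited from their
  bases. Otherwise, over some value of it, one has an empty section and the other does not, and each
  value weighs at least \<open>p\<close> because \<open>p <= 1 / 2\<close>.\<close>

lemma subcube_rigid: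
  assumes "0 < p" "p \<le> 1 / 2" "subcube n S" "subcube n T" "S \<noteq> T"
  shows "p * min (biased_measure n p S) (biased_measure n p T) \<le> biased_measure n p (sdiff S T)"
  using assms(3-5)
proof (induction n arbitrary: S T)
  case 0
  then show ?case by (simp add: subcube_0)
next
  case (Suc n)
  obtain S' B where S: "subcube n S'" "B \<in> {{0}, {1}, {0, 1}}" "S = cyl n B S'"
    using Suc.prems by (elim subcube_SucE)
  obtain T' C where T: "subcube n T'" "C \<in> {{0}, {1}, {0, 1}}" "T = cyl n C T'"
    using Suc.prems by (elim subcube_SucE)
  note sub = subcube_subset[OF S(1)] subcube_subset[OF T(1)]
  define s t d where "s = biased_measure n p S'" "t = biased_measure n p T'"
    "d = biased_measure n p (sdiff S' T')"
  have nonneg: "0 \<le> s" "0 \<le> t" "0 \<le> d"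
    using assms by (auto simp: s_t_d_def intro!: biased_measure_nonneg)
  have mS: "biased_measure (Suc n) p S = (if 1 \<in> B then p * s else 0) + (if 0 \<in> B then (1 - p) * s else 0)"
    using sub S by (simp add: biased_measure_Suc sect_cyl s_t_d_def)
  have mT: "biased_measure (Suc n) p T = (if 1 \<in> C then p * t else 0) + (if 0 \<in> C then (1 - p) * t else 0)"
    using sub T by (simp add: biased_measure_Suc sect_cyl s_t_d_def)
  have mST: "biased_measure (Suc n) p (sdiff S T) =
    p * (if 1 \<in> B then if 1 \<in> C then d else s else if 1 \<in> C then t else 0)
    + (1 - p) * (if 0 \<in> B then if 0 \<in> C then d else s else if 0 \<in> C then t else 0)"
    using sub S T by (simp add: biased_measure_cyl sect_cyl s_t_d_def)
  have avg: "p * w + (1 - p) * w = w" for w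
    by (simp add: algebra_simps)
  have le: "p * w \<le> (1 - p) * w" "p * (p * w) \<le> p * w" "0 \<le> p * w" "0 \<le> (1 - p) * w" if "0 \<le> w" for w
    using that assms(1,2) mult_right_mono[of p 1 "p * w"] by (simp_all add: mult_right_mono)
  note pt = le[OF nonneg(1)] le[OF nonneg(2)] le[OF nonneg(3)]
  show ?case
  proof (cases "B = C")
    case True
    then have "S' \<noteq> T'"
      using Suc.prems S T by auto
    then have IH: "p * min s t \<le> d"
      using Suc.IH S T by (simp add: s_t_d_def)
    have scale: "p * min (w * s) (w * t) \<le> w * d" if "0 \<le> w" for w
    proof -
      have "min (w * s) (w * t) = w * min s t"
        using that by (simp add: min_mult_distrib_left)
      then have "p * min (w * s) (w * t) = w * (p * min s t)"
        by (simp only: mult.left_commute)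
      then show ?thesis
        using mult_left_mono[OF IH that] by (simp only:)
    qed
    consider "B = {0}" | "B = {1}" | "B = {0, 1}"
      using S(2) by auto
    then show ?thesis
      using scale[of p] scale[of "1 - p"] scale[of 1] assms(1,2)
      by cases (simp_all add: mS mT mST True[symmetric] avg)
  next
    case False
    have "p * biased_measure (Suc n) p S \<le> biased_measure (Suc n) p (sdiff S T)
        \<or> p * biased_measure (Suc n) p T \<le> biased_measure (Suc n) p (sdiff S T)"
    proof -
      consider "B = {0}" "C = {1}" | "B = {0}" "C = {0, 1}" | "B = {1}" "C = {0}"
        | "B = {1}" "C = {0, 1}" | "B = {0, 1}" "C = {0}" | "B = {0, 1}" "C = {1}"
        using S(2) T(2) False by auto
      then show ?thesis
        using pt by cases (simp_all add: mS mT mST avg)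
    qed
    moreover have "p * min u v \<le> p * u" "p * min u v \<le> p * v" for u v
      using assms by auto
    ultimately show ?thesis
      by (meson order_trans)
  qed
qed

section \<open>Induction on the dimension\<close>

lemma optimal_subcube:
  obtains T where "subcube n T"
    "\<And>S. subcube n S \<Longrightarrow> biased_measure n p (sdiff A T) \<le> biased_measure n p (sdiff A S)"
proof -
  have "finite {S. subcube n S}"
    by (rule finite_subset[of _ "Pow (cube n)"]) (auto dest: subcube_subset)
  moreover have "subcube n (cube n)"
    unfolding subcube_def by (intro exI[of _ "{}"]) auto
  ultimately obtain T where "is_arg_min (\<lambda>S. biased_measure n p (sdiff A S)) (subcube n) T"
    using ex_is_arg_min_if_finite[of "{S. subcube n S}"] by auto
  then show ?thesis
    using that unfolding is_arg_min_def by (metis not_le)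
qed

text \<open>The bracket is the contribution of the last coordinate. When both sections are nonempty,
  its logarithmic part is \<open>- m * kl q p\<close> with \<open>q = p u / m\<close>.\<close>

lemma deficit_Suc:
  fixes n p A
  defines "u \<equiv> biased_measure n p (sect n 1 A)" and "v \<equiv> biased_measure n p (sect n 0 A)"
    and "m \<equiv> biased_measure (Suc n) p A"
  shows "deficit (Suc n) p A = p * deficit n p (sect n 1 A) + (1 - p) * deficit n p (sect n 0 A)
    + (ln (1 / p) * p * biased_measure n p (sdiff (sect n 1 A) (sect n 0 A))
       + m * ln m - p * u * ln u - (1 - p) * v * ln v)"
  by (simp add: deficit_def set_influence_Suc u_def v_def m_def algebra_simps)

text \<open>
  The optimality of \<open>S1\<close> and \<open>S0\<close> bounds the difference of \<open>e1\<close> and \<open>e0\<close> by the measure of the symmetric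
  difference of the sections.
\<close>

lemma deficit_step_sections:
  fixes n p A S1 S0 T
  defines "A1 \<equiv> sect n 1 A" and "A0 \<equiv> sect n 0 A"
  defines "u \<equiv> biased_measure n p A1" and "v \<equiv> biased_measure n p A0"
    and "m \<equiv> biased_measure (Suc n) p A"
    and "e1 \<equiv> biased_measure n p (sdiff A1 S1)" and "e0 \<equiv> biased_measure n p (sdiff A0 S0)"
    and "e \<equiv> biased_measure (Suc n) p (sdiff A T)"
  assumes p: "0 < p" "p \<le> 1 / 2" and "A1 \<noteq> {}" "A0 \<noteq> {}"
    and S1: "subcube n S1" and S0: "subcube n S0"
    and opt1: "\<And>S. subcube n S \<Longrightarrow> e1 \<le> biased_measure n p (sdiff A1 S)"
    and opt0: "\<And>S. subcube n S \<Longrightarrow> e0 \<le> biased_measure n p (sdiff A0 S)"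
    and opt: "\<And>S. subcube (Suc n) S \<Longrightarrow> e \<le> biased_measure (Suc n) p (sdiff A S)"
    and e1u: "e1 \<le> u" and e0v: "e0 \<le> v"
    and D1: "u * phi (e1 / u) / 1000 \<le> deficit n p A1"
    and D0: "v * phi (e0 / v) / 1000 \<le> deficit n p A0"
  shows "e \<le> m \<and> m * phi (e / m) / 1000 \<le> deficit (Suc n) p A"
proof -
  define I where "I = biased_measure n p (sdiff A1 A0)"
  have p1: "0 \<le> p" "p \<le> 1" "p < 1" using p by auto
  have pos: "0 < u" "0 < v"
    using assms(3-4) \<open>A1 \<noteq> {}\<close> \<open>A0 \<noteq> {}\<close> p p1
    by (auto simp: A1_def A0_def intro!: biased_measure_pos sect_subset)
  have m_eq: "m = p * u + (1 - p) * v"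
    by (simp add: m_def u_def v_def A1_def A0_def biased_measure_Suc)
  have "0 < p * u" "0 < (1 - p) * v"
    using p pos by auto
  then have m_pos: "0 < m" and pu_m: "p * u < m"
    by (auto simp: m_eq)
  have nonneg: "0 \<le> e1" "0 \<le> e0" "0 \<le> e" "0 \<le> I"
    using p1 by (auto simp: e1_def e0_def e_def I_def intro!: biased_measure_nonneg)
  have uv: "u \<le> v + I" "v \<le> u + I"
    using biased_measure_le_sdiff[OF p1(1,2), of n A1 A0] biased_measure_le_sdiff[OF p1(1,2), of n A0 A1]
    by (auto simp: u_def v_def I_def sdiff_commute)
  have um: "u - m = (1 - p) * (u - v)" and vm: "v - m = p * (v - u)"
    by (auto simp: m_eq algebra_simps)
  have cross1: "biased_measure n p (sdiff A0 S1) \<le> I + e1"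
    using biased_measure_sdiff_triangle[OF p1(1,2), of n A0 S1 A1]
    by (simp add: I_def e1_def sdiff_commute)
  have cross0: "biased_measure n p (sdiff A1 S0) \<le> I + e0"
    using biased_measure_sdiff_triangle[OF p1(1,2), of n A1 S0 A0]
    by (simp add: I_def e0_def)
  have e10: "e1 \<le> I + e0" "e0 \<le> I + e1"
    using opt1[OF S0] opt0[OF S1] cross0 cross1 by auto
  have cand: "e \<le> p * biased_measure n p (sdiff A1 (if 1 \<in> B then S else {}))
      + (1 - p) * biased_measure n p (sdiff A0 (if 0 \<in> B then S else {}))"
    if "subcube n S" "B \<in> {{0}, {1}, {0, 1}}" for S and B :: "nat set"
    using opt[OF subcube_cyl[OF that]] biased_measure_cyl[OF subcube_subset[OF that(1)], of p A B]
    by (simp add: A1_def A0_def)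
  have c1: "e \<le> p * e1 + (1 - p) * v"
    using cand[OF S1, of "{1}"] by (simp add: e1_def v_def)
  have c0: "e \<le> p * u + (1 - p) * e0"
    using cand[OF S0, of "{0}"] by (simp add: e0_def u_def)
  have "e \<le> p * e1 + (1 - p) * biased_measure n p (sdiff A0 S1)"
    using cand[OF S1, of "{0, 1}"] by (simp add: e1_def)
  also have "\<dots> \<le> p * e1 + (1 - p) * (I + e1)"
    using cross1 p by (intro add_left_mono mult_left_mono) auto
  finally have ca: "e \<le> e1 + (1 - p) * I"
    by (simp add: algebra_simps)
  have "e \<le> p * biased_measure n p (sdiff A1 S0) + (1 - p) * e0"
    using cand[OF S0, of "{0, 1}"] by (simp add: e0_def)
  also have "\<dots> \<le> p * (I + e0) + (1 - p) * e0"
    using cross0 p by (intro add_right_mono mult_left_mono) auto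
  finally have cb: "e \<le> e0 + p * I"
    by (simp add: algebra_simps)

  \<comment> \<open>The relative quantities of \<open>deficit_step\<close>: \<open>q\<close> is the
    share of \<open>A\<close> where the last coordinate is 1, and each error is divided by the
    measure of its own set.\<close>
  define q a b x z where "q = p * u / m" "a = e1 / u" "b = e0 / v" "x = I / m" "z = e / m"
  note defs = q_a_b_x_z_def
  have q1: "1 - q = (1 - p) * v / m"
    using m_pos by (simp add: defs field_simps m_eq)
  have q: "0 < q" "q < 1"
    using p pos m_pos pu_m by (auto simp: defs)
  have ab: "0 \<le> a" "a \<le> 1" "0 \<le> b" "b \<le> 1"
    using nonneg pos e1u e0v by (auto simp: defs)
  have qa: "q * a = p * e1 / m" and qb: "(1 - q) * b = (1 - p) * e0 / m"
    unfolding q1 using pos by (auto simp: defs)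
  have "q - p = p * (u - m) / m"
    using m_pos by (simp add: defs field_simps)
  then have "q - p = p * (1 - p) * ((u - v) / m)"
    by (simp add: um)
  then have "\<bar>q - p\<bar> / (p * (1 - p)) = \<bar>u - v\<bar> / m"
    using p m_pos by (simp add: abs_mult)
  also have "\<dots> \<le> x"
    using uv m_pos by (auto simp: defs divide_right_mono)
  finally have x: "\<bar>q - p\<bar> / (p * (1 - p)) \<le> x" .
  have z1: "z \<le> q * a + (1 - q)"
    using c1 m_pos unfolding qa q1 by (simp add: defs add_divide_distrib[symmetric] divide_right_mono)
  have z0: "z \<le> (1 - q) * b + q"
    using c0 m_pos unfolding qb by (simp add: defs add_divide_distrib[symmetric] divide_right_mono add.commute)
  \<comment> \<open>One \<open>I\<close> is the cost of using \<open>S1\<close> for the other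
    section, the second that of changing the normalisation of \<open>e1\<close> from
    \<open>u\<close> to \<open>m\<close>.\<close>
  have za: "z \<le> a + 2 * x"
  proof -
    have "(u - m) * a = (1 - p) * a * (u - v)"
      by (simp add: um)
    also have "\<dots> \<le> (1 - p) * a * I"
      using uv p ab by (intro mult_left_mono) auto
    also have "\<dots> \<le> 1 * I"
      using p ab nonneg by (intro mult_right_mono mult_le_one) auto
    finally have "e1 \<le> m * a + I"
      using pos by (simp add: defs field_simps)
    moreover have "(1 - p) * I \<le> 1 * I"
      using p nonneg by (intro mult_right_mono) auto
    ultimately have "e \<le> m * a + 2 * I"
      using ca by simp
    then show ?thesis
      using m_pos unfolding defs(4,5) by (simp add: field_simps)
  qed
  \<comment> \<open>Both costs now carry a factor \<open>p\<close>: the section at 1 has weight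
    \<open>p\<close>, and \<open>v - m = p (v - u)\<close>.\<close>
  have zb: "z \<le> b + 2 * p * x"
  proof -
    have "(v - m) * b = p * b * (v - u)"
      by (simp add: vm)
    also have "\<dots> \<le> p * b * I"
      using uv p ab by (intro mult_left_mono) auto
    also have "\<dots> \<le> p * 1 * I"
      using p ab nonneg by (intro mult_right_mono mult_left_mono) auto
    finally have "e0 \<le> m * b + p * I"
      using pos by (simp add: defs field_simps)
    then have "e \<le> m * b + 2 * p * I"
      using cb by simp
    then show ?thesis
      using m_pos unfolding defs(4,5) by (simp add: field_simps)
  qed
  have rigid: "z \<le> q * a + (1 - q) * b" if xs: "x < p / 100" and abs: "a < p / 100 \<or> b < p / 100"
  proof -
    have I: "I < p * m / 100"
      using xs m_pos by (simp add: defs field_simps)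
    have "(1 - p) * \<bar>u - v\<bar> \<le> 1 * I" "p * \<bar>u - v\<bar> \<le> 1 * I"
      using uv p by (intro mult_mono; auto)+
    then have um': "\<bar>u - m\<bar> \<le> I" "\<bar>v - m\<bar> \<le> I"
      using p by (auto simp: um vm abs_mult abs_minus_commute)
    have "p * m \<le> 1 / 2 * m"
      using p m_pos by (intro mult_right_mono) auto
    then have pm: "p * m \<le> m / 2" by simp
    have pm_pos: "0 < p * m" using p m_pos by simp
    have small: "p * w / 100 < p * m / 50" if "w \<le> m + I" for w
    proof -
      have "p * w \<le> p * (m + I)"
        using that p by (intro mult_left_mono) auto
      moreover have "p * I \<le> 1 * I"
        using p nonneg by (intro mult_right_mono) auto
      ultimately have "p * w \<le> p * m + I"
        by (simp add: algebra_simps)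
      then show ?thesis using I pm_pos by linarith
    qed
    have "e1 < p * u / 100 \<or> e0 < p * v / 100"
      using abs pos by (auto simp: defs field_simps)
    then have "e1 < p * m / 50 \<or> e0 < p * m / 50"
      using small[of u] small[of v] um' by linarith
    then have e: "e1 < p * m * 3 / 100" "e0 < p * m * 3 / 100"
      using e10 I by linarith+
    \<comment> \<open>With both errors below \<open>3 p m / 100\<close> and \<open>I\<close> below
      \<open>p m / 100\<close>, the two subcubes differ by less than \<open>7 p m / 100\<close>. If
      they were distinct, rigidity would force one to have measure below \<open>7 m / 100\<close>,
      though it approximates a section of measure close to \<open>m\<close>.\<close>
    have "S0 = S1"
    proof (rule ccontr)
      assume "S0 \<noteq> S1"
      then have "p * min (biased_measure n p S0) (biased_measure n p S1) \<le> biased_measure n p (sdiff S0 S1)"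
        using subcube_rigid p S0 S1 by blast
      also have "\<dots> \<le> biased_measure n p (sdiff S0 A0) + biased_measure n p (sdiff A0 S1)"
        by (rule biased_measure_sdiff_triangle[OF p1(1,2)])
      also have "\<dots> \<le> e0 + (I + e1)"
        using cross1 by (simp add: e0_def sdiff_commute)
      also have "\<dots> < p * m * (7 / 100)"
        using e I by linarith
      also have "\<dots> = p * (m * (7 / 100))"
        by simp
      finally have "min (biased_measure n p S0) (biased_measure n p S1) < m * (7 / 100)"
        using p by (simp add: mult_less_cancel_left_pos)
      then have "biased_measure n p S0 < m * (7 / 100) \<or> biased_measure n p S1 < m * (7 / 100)"
        by (simp only: min_less_iff_disj)
      moreover have "u \<le> biased_measure n p S1 + e1" "v \<le> biased_measure n p S0 + e0"
        unfolding u_def v_def e1_def e0_def by (rule biased_measure_le_sdiff[OF p1(1,2)])+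
      ultimately show False
        using um' I e pm m_pos by linarith
    qed
    then have "e \<le> p * e1 + (1 - p) * e0"
      using cand[OF S0, of "{0, 1}"] by (simp add: e1_def e0_def)
    then show ?thesis
      using m_pos unfolding qa qb by (simp add: defs add_divide_distrib[symmetric] divide_right_mono)
  qed
  \<comment> \<open>Optimality bounds the difference of \<open>e1\<close> and \<open>e0\<close> by
    \<open>I\<close>, and the different divisors cost another \<open>I\<close>. The bound on
    \<open>q\<close> means \<open>u >= m / 2\<close>, which doubles the total.\<close>
  have diff: "\<bar>a - b\<bar> \<le> 4 * x" if "p / 2 \<le> q"
  proof -
    have "m / 2 \<le> u"
      using that p m_pos by (simp add: defs field_simps)
    have "(a - b) * u = (e1 - e0) + (v - u) * b"
      using pos by (simp add: defs field_simps)
    moreover have "\<bar>(v - u) * b\<bar> \<le> I * 1"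
      unfolding abs_mult using uv ab nonneg by (intro mult_mono) auto
    ultimately have "\<bar>(a - b) * u\<bar> \<le> 2 * I"
      using e10 by linarith
    then have "\<bar>a - b\<bar> * u \<le> 2 * I"
      using pos by (simp add: abs_mult)
    moreover have "\<bar>a - b\<bar> * (m / 2) \<le> \<bar>a - b\<bar> * u"
      using \<open>m / 2 \<le> u\<close> by (intro mult_left_mono) auto
    ultimately show ?thesis
      using m_pos unfolding defs(4) by (simp add: field_simps)
  qed
  have "phi z / 1000 \<le> (q * phi a + (1 - q) * phi b) / 1000 + (ln (1 / p) * p * x - kl q p)"
    using deficit_step[OF p q ab _ x z1 z0 za zb rigid diff] nonneg m_pos by (simp add: defs)
  then have "m * (phi z / 1000) \<le> m * ((q * phi a + (1 - q) * phi b) / 1000 + (ln (1 / p) * p * x - kl q p))"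
    using m_pos by (intro mult_left_mono) auto
  also have "\<dots> = (m * q * phi a + m * (1 - q) * phi b) / 1000 + (ln (1 / p) * p * (m * x) - m * kl q p)"
    by (simp add: field_simps)
  also have "m * q = p * u"
    using m_pos by (simp add: defs)
  also have "m * (1 - q) = (1 - p) * v"
    unfolding q1 using m_pos by simp
  also have "m * x = I"
    using m_pos by (simp add: defs)
  also have "m * kl q p = p * u * ln u + (1 - p) * v * ln v - m * ln m"
  proof -
    have r: "q / p = u / m" "(1 - q) / (1 - p) = v / m"
      unfolding q1 using p by (auto simp: defs)
    have "m * kl q p = (m * q) * (ln u - ln m) + (m * (1 - q)) * (ln v - ln m)"
      unfolding kl_def r using pos m_pos by (simp add: ln_div algebra_simps)
    also have "\<dots> = p * u * (ln u - ln m) + (1 - p) * v * (ln v - ln m)"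
      unfolding q1 using m_pos by (simp add: defs)
    finally show ?thesis
      by (simp add: m_eq algebra_simps)
  qed
  also have "(p * u * phi a + (1 - p) * v * phi b) / 1000 = p * (u * phi a / 1000) + (1 - p) * (v * phi b / 1000)"
    by (simp add: add_divide_distrib)
  also have "\<dots> \<le> p * deficit n p A1 + (1 - p) * deficit n p A0"
    using p D1 D0 by (intro add_mono mult_left_mono) (auto simp: defs)
  finally have "m * (phi z / 1000) \<le> deficit (Suc n) p A"
    unfolding deficit_Suc by (simp add: A1_def A0_def u_def v_def m_def I_def)
  moreover have "q * a + (1 - q) \<le> q * 1 + (1 - q)"
    using q ab by (intro add_right_mono mult_left_mono) auto
  then have "z \<le> 1"
    using z1 by simp
  then have "e \<le> m"
    using m_pos by (simp add: defs)
  ultimately show ?thesis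
    by (simp add: defs)
qed

lemma deficit_0: "deficit 0 p (cube 0) = 0"
  by (simp add: deficit_def set_influence_def biased_measure_def biased_mass_def cube_0)

text \<open>Optimality belongs to the induction claim: it makes the errors of the two sections
  comparable. The bound by the measure of \<open>A\<close> keeps the relative error in [0, 1], where
  \<open>phi\<close> is monotone.\<close>

lemma deficit_ge:
  assumes p: "0 < p" "p \<le> 1 / 2" and A: "A \<subseteq> cube n" "A \<noteq> {}"
  obtains T where "subcube n T"
    "\<And>S. subcube n S \<Longrightarrow> biased_measure n p (sdiff A T) \<le> biased_measure n p (sdiff A S)"
    "biased_measure n p (sdiff A T) \<le> biased_measure n p A"
    "biased_measure n p A * phi (biased_measure n p (sdiff A T) / biased_measure n p A) / 1000
       \<le> deficit n p A"
  using A
proof (induction n arbitrary: A thesis)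
  case 0
  then have "A = cube 0"
    by (auto simp: cube_0)
  then show ?case
    using p by (intro 0(1)[of "cube 0"])
      (auto simp: deficit_0 subcube_0 intro!: biased_measure_nonneg)
next
  case (Suc n)
  obtain T where T: "subcube (Suc n) T" "\<And>S. subcube (Suc n) S \<Longrightarrow>
      biased_measure (Suc n) p (sdiff A T) \<le> biased_measure (Suc n) p (sdiff A S)"
    using optimal_subcube[where n = "Suc n" and p = p and A = A] by metis
  define A1 A0 where "A1 = sect n 1 A" and "A0 = sect n 0 A"
  define u v m e where "u = biased_measure n p A1" "v = biased_measure n p A0"
    "m = biased_measure (Suc n) p A" "e = biased_measure (Suc n) p (sdiff A T)"
  note defs = u_v_m_e_def
  have p1: "0 \<le> p" "p \<le> 1" "p < 1" using p by auto
  have m_eq: "m = p * u + (1 - p) * v"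
    by (simp add: defs A1_def A0_def biased_measure_Suc)
  have e_nonneg: "0 \<le> e"
    using p1 by (auto simp: defs intro!: biased_measure_nonneg)
  have sub: "A1 \<subseteq> cube n" "A0 \<subseteq> cube n"
    by (auto simp: A1_def A0_def sect_def)
  have cand: "e \<le> p * biased_measure n p (sdiff A1 (if 1 \<in> B then S else {}))
      + (1 - p) * biased_measure n p (sdiff A0 (if 0 \<in> B then S else {}))"
    if "subcube n S" "B \<in> {{0}, {1}, {0, 1}}" for S and B :: "nat set"
    using T(2)[OF subcube_cyl[OF that]] biased_measure_cyl[OF subcube_subset[OF that(1)], of p A B]
    by (simp add: A1_def A0_def defs)
  have "e \<le> m \<and> m * phi (e / m) / 1000 \<le> deficit (Suc n) p A"
  proof (cases "A1 = {} \<or> A0 = {}")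
    case False
    obtain S1 where S1: "subcube n S1"
      "\<And>S. subcube n S \<Longrightarrow> biased_measure n p (sdiff A1 S1) \<le> biased_measure n p (sdiff A1 S)"
      "biased_measure n p (sdiff A1 S1) \<le> u"
      "u * phi (biased_measure n p (sdiff A1 S1) / u) / 1000 \<le> deficit n p A1"
      using Suc.IH[of A1] False sub by (auto simp: defs)
    obtain S0 where S0: "subcube n S0"
      "\<And>S. subcube n S \<Longrightarrow> biased_measure n p (sdiff A0 S0) \<le> biased_measure n p (sdiff A0 S)"
      "biased_measure n p (sdiff A0 S0) \<le> v"
      "v * phi (biased_measure n p (sdiff A0 S0) / v) / 1000 \<le> deficit n p A0"
      using Suc.IH[of A0] False sub by (auto simp: defs)
    show ?thesis
      using deficit_step_sections[of p n A S1 S0 T] p False S1 S0 T(2)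
      unfolding defs A1_def A0_def by blast
  next
    case True
    \<comment> \<open>Only the section \<open>B\<close> is nonempty, over a value of weight
      \<open>w\<close>. A cylinder over its subcube keeps the relative error, and the last
      coordinate adds \<open>k (w ln w - p ln p)\<close>, which is 0 for \<open>w = p\<close> and
      nonnegative for \<open>w = 1 - p\<close> by \<open>entropy_halves_le\<close>.\<close>
    define B where "B = (if A1 = {} then A0 else A1)"
    define w where "w = (if A1 = {} then 1 - p else p)"
    define k where "k = biased_measure n p B"
    have "B \<noteq> {}"
      using sect_nonempty[of A n] Suc.prems True by (auto simp: B_def A1_def A0_def)
    moreover have "B \<subseteq> cube n"
      using sub by (simp add: B_def)
    ultimately have k: "0 < k"
      using p1 p by (auto simp: k_def intro!: biased_measure_pos)
    obtain S where S: "subcube n S" "biased_measure n p (sdiff B S) \<le> k"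
      "k * phi (biased_measure n p (sdiff B S) / k) / 1000 \<le> deficit n p B"
      using Suc.IH[of B] \<open>B \<noteq> {}\<close> \<open>B \<subseteq> cube n\<close> unfolding k_def by metis
    have w: "0 < w" using p p1 by (simp add: w_def)
    have m: "m = w * k"
      using True by (auto simp: m_eq w_def k_def defs B_def)
    have e: "e \<le> w * biased_measure n p (sdiff B S)"
      using cand[OF S(1), of "{0}"] cand[OF S(1), of "{1}"] True
      by (cases "A1 = {}") (simp_all add: w_def B_def)
    have "w * biased_measure n p (sdiff B S) \<le> w * k"
      using S(2) w by (intro mult_left_mono) auto
    then have em: "e \<le> m"
      using e m by simp
    have "phi (e / m) \<le> phi (biased_measure n p (sdiff B S) / k)"
      using e S(2) k w e_nonneg by (intro phi_mono) (auto simp: m field_simps)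
    then have "m * phi (e / m) / 1000 \<le> w * (k * phi (biased_measure n p (sdiff B S) / k) / 1000)"
      using w k by (simp add: m)
    also have "\<dots> \<le> w * deficit n p B"
      using S(3) w by (intro mult_left_mono) auto
    also have "\<dots> \<le> deficit (Suc n) p A"
    proof -
      have [simp]: "deficit n p {} = 0"
        by (simp add: deficit_def set_influence_def)
      have *: "deficit (Suc n) p A = w * deficit n p B
          + (ln (1 / p) * p * k + w * k * ln (w * k) - w * k * ln k)"
        using True unfolding deficit_Suc A1_def[symmetric] A0_def[symmetric] defs(3)[symmetric] m
        by (auto simp: w_def k_def B_def)
      have "ln (1 / p) * p * k + w * k * ln (w * k) - w * k * ln k = k * (w * ln w - p * ln p)"
        using w k p by (simp add: ln_mult ln_div algebra_simps)
      moreover have "0 \<le> w * ln w - p * ln p"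
        using entropy_halves_le[OF p] by (simp add: w_def)
      ultimately show ?thesis
        using k * by simp
    qed
    finally show ?thesis
      using em by blast
  qed
  then show ?case
    using Suc.prems(1)[OF T] by (simp add: defs)
qed

section \<open>Inversion of \<open>phi\<close> and the conclusion\<close>

lemma phi_le_imp_le:
  assumes "0 \<le> y" "y \<le> 1" "phi y / 1000 \<le> \<delta>" "\<delta> \<le> 1 / 10 ^ 6"
  shows "y \<le> 2000 * (\<delta> / ln (1 / \<delta>))"
proof (cases "y = 0")
  case True
  then show ?thesis
    using assms by (cases "\<delta> = 0") (auto intro!: divide_nonneg_nonneg)
next
  case False
  then have y: "0 < y" "y \<le> 1000 * \<delta>"
    using assms phi_ge_self[of y] by auto
  then have \<delta>: "0 < \<delta>" by auto
  \<comment> \<open>Bootstrapping: the crude bound \<open>y <= 1000 \<delta>\<close> and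
    \<open>(1000 \<delta>)^2 <= \<delta>\<close>, the source of \<open>1 / 10 ^ 6\<close>, show that
    \<open>- ln y\<close> is at least half of \<open>ln (1 / \<delta>)\<close>.\<close>
  have "ln (1000 * \<delta> * (1000 * \<delta>)) \<le> ln \<delta>"
    using \<delta> assms by (simp add: field_simps)
  moreover have "ln (1000 * \<delta> * (1000 * \<delta>)) = ln (1000 * \<delta>) + ln (1000 * \<delta>)"
    using \<delta> ln_mult[of "1000 * \<delta>" "1000 * \<delta>"] by simp
  ultimately have "2 * ln (1000 * \<delta>) \<le> ln \<delta>"
    by linarith
  moreover have "ln y \<le> ln (1000 * \<delta>)"
    using y by simp
  ultimately have "ln (1 / \<delta>) / 2 \<le> 1 - ln y"
    using \<delta> by (simp add: ln_div)
  then have "y * (ln (1 / \<delta>) / 2) \<le> phi y"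
    unfolding phi_def using y by (intro mult_left_mono) auto
  then have "y * (ln (1 / \<delta>) / 2) \<le> 1000 * \<delta>"
    using assms by simp
  moreover have "0 < ln (1 / \<delta>)"
    using \<delta> assms by simp
  ultimately show ?thesis
    by (simp add: field_simps)
qed

theorem theorem1p7:
  shows "\<exists>c\<^sub>0 C\<^sub>1 :: real. c\<^sub>0 > 0 \<and> C\<^sub>1 > 0 \<and>
    (\<forall>(n::nat) (p::real) (\<epsilon>::real) (f :: (nat \<Rightarrow> nat) \<Rightarrow> nat).
       n \<ge> 1 \<longrightarrow> 0 < p \<longrightarrow> p \<le> 1 / 2 \<longrightarrow> \<epsilon> \<le> c\<^sub>0 / ln (1 / p) \<longrightarrow>
       f \<in> cube n \<rightarrow> {0, 1} \<longrightarrow> (\<exists>x\<in>cube n. f x \<noteq> 0) \<longrightarrow>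
       p * total_influence n p f \<le> biased_mean n p f * (log p (biased_mean n p f) + \<epsilon>) \<longrightarrow>
       (\<exists>S. subcube n S \<and>
          biased_measure n p (sym_diff_set n f (indicator S))
            \<le> C\<^sub>1 * (\<epsilon> * ln (1 / p) / ln (1 / (\<epsilon> * ln (1 / p)))) * biased_mean n p f))"
proof (rule exI[of _ "1 / 10 ^ 6"], rule exI[of _ 2000], intro conjI allI impI)
  fix n :: nat and p \<epsilon> :: real and f :: "(nat \<Rightarrow> nat) \<Rightarrow> nat"
  assume p: "0 < p" "p \<le> 1 / 2" and \<epsilon>: "\<epsilon> \<le> 1 / 10 ^ 6 / ln (1 / p)"
    and f: "f \<in> cube n \<rightarrow> {0, 1}" and nz: "\<exists>x\<in>cube n. f x \<noteq> 0"
    and hyp: "p * total_influence n p f \<le> biased_mean n p f * (log p (biased_mean n p f) + \<epsilon>)"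
  define A where "A = {x \<in> cube n. f x \<noteq> 0}"
  define L where "L = ln (1 / p)"
  define m where "m = biased_measure n p A"
  have A: "A \<subseteq> cube n" "A \<noteq> {}"
    using nz by (auto simp: A_def)
  have f01: "f x = 0 \<or> f x = 1" if "x \<in> cube n" for x
    using funcset_mem[OF f that] by auto
  have mean: "biased_mean n p f = m"
    unfolding biased_mean_def m_def biased_measure_alt A_def
    by (rule sum.cong[OF refl]) (use f01 in force)
  have infl: "total_influence n p f = set_influence n p A"
    unfolding total_influence_def set_influence_def influence_def
  proof (rule sum.cong[OF refl])
    fix i assume i: "i \<in> {1..n}"
    have "f x \<noteq> f (flip_coord x i) \<longleftrightarrow> (x \<in> A) \<noteq> (flip_coord x i \<in> A)" if x: "x \<in> cube n" for x
      using f01[OF x] f01[OF flip_coord_in_cube[OF x i]] x flip_coord_in_cube[OF x i]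
      by (auto simp: A_def)
    then have "{x \<in> cube n. f x \<noteq> f (flip_coord x i)} =
        {x \<in> cube n. (x \<in> A) \<noteq> (flip_coord x i \<in> A)}"
      by blast
    then show "biased_measure n p {x \<in> cube n. f x \<noteq> f (flip_coord x i)} =
        biased_measure n p {x \<in> cube n. (x \<in> A) \<noteq> (flip_coord x i \<in> A)}"
      by (rule arg_cong)
  qed
  obtain S where S: "subcube n S" and le: "biased_measure n p (sdiff A S) \<le> m"
    and D: "m * phi (biased_measure n p (sdiff A S) / m) / 1000 \<le> deficit n p A"
    using deficit_ge[OF p A] unfolding m_def by metis
  have diff: "sym_diff_set n f (indicator S) = sdiff A S"
    using f01 subcube_subset[OF S]
    by (fastforce simp: sym_diff_set_def sdiff_def A_def indicator_def split: if_splits)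
  define y where "y = biased_measure n p (sdiff A S) / m"
  have m: "0 < m"
    using A p by (auto simp: m_def intro!: biased_measure_pos)
  have L: "0 < L"
    using p by (simp add: L_def)
  have y: "0 \<le> y" "y \<le> 1"
    using le m p by (auto simp: y_def intro!: divide_nonneg_nonneg biased_measure_nonneg)
  \<comment> \<open>Multiplying by \<open>L\<close> turns \<open>log p m\<close> into
    \<open>- ln m\<close> and bounds the deficit by \<open>m * (\<epsilon> * L)\<close>;
    \<open>phi_le_imp_le\<close> at \<open>\<delta> = \<epsilon> * L\<close> then accounts for both
    absolute constants.\<close>
  have "L * (p * set_influence n p A) \<le> L * (m * (log p m + \<epsilon>))"
    using hyp L unfolding mean infl by (intro mult_left_mono) auto
  also have "L * (m * (log p m + \<epsilon>)) = m * (L * log p m) + m * (\<epsilon> * L)"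
    by (simp add: algebra_simps)
  also have "L * log p m = - ln m"
    using L p by (simp add: L_def log_def ln_div)
  finally have "deficit n p A \<le> m * (\<epsilon> * L)"
    by (simp add: deficit_def L_def[symmetric] m_def[symmetric] mult.assoc)
  then have "m * (phi y / 1000) \<le> m * (\<epsilon> * L)"
    using D by (simp add: y_def)
  then have "phi y / 1000 \<le> \<epsilon> * L"
    using m by (simp only: mult_le_cancel_left_pos)
  moreover have "\<epsilon> * L \<le> 1 / 10 ^ 6"
    using \<epsilon> L by (simp add: L_def[symmetric] field_simps)
  ultimately have "y \<le> 2000 * (\<epsilon> * L / ln (1 / (\<epsilon> * L)))"
    using y by (intro phi_le_imp_le)
  then have "biased_measure n p (sdiff A S) \<le> 2000 * (\<epsilon> * L / ln (1 / (\<epsilon> * L))) * m"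
    using m unfolding y_def by (simp only: pos_divide_le_eq)
  then show "\<exists>S. subcube n S \<and> biased_measure n p (sym_diff_set n f (indicator S))
      \<le> 2000 * (\<epsilon> * ln (1 / p) / ln (1 / (\<epsilon> * ln (1 / p)))) * biased_mean n p f"
    using S by (intro exI[of _ S]) (simp add: diff mean L_def)
qed simp_all

end
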